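(* Let $k$ be a field, $I\subseteq k[x_1,\dots,x_n]$ an ideal, and $\prec_1,\prec_2$ rational term orders given by $\mathbb{Q}$-bases $\omega=(\omega_1,\dots,\omega_n)$ and $\tau=(\tau_1,\dots,\tau_n)$ of $\mathbb{Q}^n$, respectively. Let $T$ be the $n\times n$ matrix with rows $\tau_1,\dots,\tau_n$, and put $$M_\tau=\{\langle\tau_i,u\rangle v\mid i=1,\dots,n;\ u,v\in\partial(I)\}.$$ There exists a (sufficiently small) rational $\delta>0$ such that $$\text{(a)}\qquad u\prec_1v\iff\langle\omega_\delta,u\rangle<\langle\omega_\delta,v\rangle\quad\text{for all }u,v\in M_\tau.$$ Given $\delta$ satisfying (a), put $$N_\delta=\{\langle\omega_\delta,u\rangle v\mid u,v\in\partial(I)\}.$$ There exists a (sufficiently small) rational $\epsilon>0$ such that $$\text{(b)}\qquad u\prec_2v\iff\langle\tau_\epsilon,u\rangle<\langle\tau_\epsilon,v\rangle\quad\text{for all }u,v\in N_\delta.$$ Suppose that $\delta>0$ satisfies (a) and that $\epsilon>0$ satisfies (b) for this $\delta$. For $v\in\partial(I)\cap C_{\prec_1,\prec_2}$ put $$t_v=\frac{\langle\omega_\delta,v\rangle}{\langle\omega_\delta,v\rangle-\langle\tau_\epsilon,v\rangle}.$$ Then for all (column vectors) $u,v\in\partial(I)\cap C_{\prec_1,\prec_2}$ we have $\langle\omega_\delta,u\rangle,\langle\omega_\delta,v\rangle>0$ and $$t_u<t_v\iff Tuv^t\prec_1Tvu^t,$$ where the $n\times n$ matrices are compared lexicographically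 row by row, rows being compared by $\prec_1$. Moreover, if $t_u=t_v$, then $Tuv^t=Tvu^t$, hence $uv^t=vu^t$, and $u$ is a positive multiple of $v$.
   Context: The rational group order given by a $\mathbb{Q}$-basis $\omega=(\omega_1,\dots,\omega_n)$ of $\mathbb{Q}^n$ is: $u\prec v$ iff $(\langle\omega_1,u\rangle,\dots,\langle\omega_n,u\rangle)$ is lexicographically smaller than $(\langle\omega_1,v\rangle,\dots,\langle\omega_n,v\rangle)$; it is a term order if $0\prec e_i$ for every canonical basis vector $e_i$. The same formula is used to compare vectors of $\mathbb{R}^n$. For rational $\eta>0$ put $\omega_\eta=\omega_1+\eta\omega_2+\cdots+\eta^{n-1}\omega_n$ and likewise $\tau_\eta=\tau_1+\eta\tau_2+\cdots+\eta^{n-1}\tau_n$. For a nonzero polynomial $f=\sum_va_vx^v$ let $\operatorname{supp}(f)=\{v\mid a_v\ne0\}$, and for a term order $\prec$ let $\partial_\prec(f)=\{u-u'\mid u'\in\operatorname{supp}(f)\setminus\{u\}\}$, where $u=\max_\prec\operatorname{supp}(f)$. For a finite set $G$ of nonzero polynomials, $\partial_\prec(G)=\bigcup_{f\in G}\partial_\prec(f)$. $\partial(I)$ denotes the union of the sets $\partial_\prec(G)$, where $G$ runs through the finitely many reduced Gröbner bases of $I$ ($G$ being the reduced Gröbner basis over the term order $\prec$). $C_{\prec_1,\prec_2}=\{v\in\mathbb{R}^n\mid0\prec_1v\text{ and }v\prec_20\}$. *)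

theory Defs
  imports "HOL-Analysis.Analysis" "HOL-Library.Poly_Mapping"
begin

section \<open>Rational group orders\<close>

text \<open>
  The index set \<open>{1,\<dots>,n}\<close> is a finite linearly ordered type \<open>'n\<close>, so that first, second, etc.
  make sense for indices and \<open>n = CARD('n)\<close>.
\<close>

type_synonym 'n qvec = "(rat, 'n) vec"
type_synonym 'n rvec = "(real, 'n) vec"
type_synonym 'n rmat = "((real, 'n) vec, 'n) vec"

definition lex_less :: "('a \<Rightarrow> 'a \<Rightarrow> bool) \<Rightarrow> ('a, 'n::{finite,linorder}) vec \<Rightarrow> ('a, 'n) vec \<Rightarrow> bool" where
  "lex_less lt a b \<longleftrightarrow> (\<exists>i. lt (a $ i) (b $ i) \<and> (\<forall>j<i. a $ j = b $ j))"

definition real_vec :: "'n::finite qvec \<Rightarrow> 'n rvec" where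
  "real_vec w = (\<chi> i. of_rat (w $ i))"

definition pairing :: "'n::finite qvec \<Rightarrow> 'n rvec \<Rightarrow> real" where
  "pairing w u = real_vec w \<bullet> u"

definition is_rat_basis :: "('n::finite \<Rightarrow> 'n qvec) \<Rightarrow> bool" where
  "is_rat_basis \<omega> \<longleftrightarrow> inj \<omega> \<and> vec.independent (range \<omega>) \<and> vec.span (range \<omega>) = UNIV"

definition rat_order :: "('n::{finite,linorder} \<Rightarrow> 'n qvec) \<Rightarrow> 'n rvec \<Rightarrow> 'n rvec \<Rightarrow> bool" where
  "rat_order \<omega> u v \<longleftrightarrow>
     lex_less (<) (\<chi> i. pairing (\<omega> i) u) (\<chi> i. pairing (\<omega> i) v)"

definition rat_term_order :: "('n::{finite,linorder} \<Rightarrow> 'n qvec) \<Rightarrow> bool" where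
  "rat_term_order \<omega> \<longleftrightarrow> is_rat_basis \<omega> \<and> (\<forall>i. rat_order \<omega> 0 (axis i 1))"

text \<open>\<open>\<omega>\<^sub>1 + \<eta> \<omega>\<^sub>2 + \<dots> + \<eta>\<^sup>n\<^sup>-\<^sup>1 \<omega>\<^sub>n\<close>; the exponent of \<open>\<eta>\<close> is the number of smaller indices.\<close>

definition perturb :: "('n::{finite,linorder} \<Rightarrow> 'n qvec) \<Rightarrow> rat \<Rightarrow> 'n qvec" where
  "perturb \<omega> \<eta> = (\<Sum>i\<in>UNIV. \<eta> ^ card {j. j < i} *s \<omega> i)"

text \<open>\<open>C\<^bsub>\<prec>\<^sub>1,\<prec>\<^sub>2\<^esub>\<close>\<close>

definition diff_cone ::
  "('n::finite rvec \<Rightarrow> 'n rvec \<Rightarrow> bool) \<Rightarrow> ('n rvec \<Rightarrow> 'n rvec \<Rightarrow> bool) \<Rightarrow> 'n rvec set" where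
  "diff_cone lt1 lt2 = {v. lt1 0 v \<and> lt2 v 0}"


section \<open>Polynomials, term orders and Groebner bases\<close>

type_synonym 'n monomial = "'n \<Rightarrow>\<^sub>0 nat"
type_synonym ('n, 'k) mpoly = "'n monomial \<Rightarrow>\<^sub>0 'k"

definition expvec :: "'n::finite monomial \<Rightarrow> 'a::semiring_1 ^ 'n" where
  "expvec m = (\<chi> i. of_nat (Poly_Mapping.lookup m i))"

definition is_ideal :: "'a::comm_ring_1 set \<Rightarrow> bool" where
  "is_ideal I \<longleftrightarrow> module.subspace (*) I"

definition ideal_generated :: "'a::comm_ring_1 set \<Rightarrow> 'a set" where
  "ideal_generated S = module.span (*) S"

text \<open>Arbitrary (not necessarily rational) term orders, as group orders on \<open>\<int>\<^sup>n\<close>.\<close>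

type_synonym 'n zorder = "(int, 'n) vec \<Rightarrow> (int, 'n) vec \<Rightarrow> bool"

definition term_order :: "'n::finite zorder \<Rightarrow> bool" where
  "term_order lt \<longleftrightarrow>
     (\<forall>u. \<not> lt u u) \<and>
     (\<forall>u v w. lt u v \<longrightarrow> lt v w \<longrightarrow> lt u w) \<and>
     (\<forall>u v. u \<noteq> v \<longrightarrow> lt u v \<or> lt v u) \<and>
     (\<forall>u v w. lt u v \<longrightarrow> lt (u + w) (v + w)) \<and>
     (\<forall>i. lt 0 (axis i 1))"

text \<open>\<open>max\<^sub>\<prec> supp(f)\<close>; only meaningful for \<open>f \<noteq> 0\<close>.\<close>

definition lead_mon ::
  "'n::finite zorder \<Rightarrow> ('n, 'k::zero) mpoly \<Rightarrow> 'n monomial" where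
  "lead_mon lt f =
     (THE u. u \<in> Poly_Mapping.keys f \<and>
             (\<forall>u'\<in>Poly_Mapping.keys f. u' \<noteq> u \<longrightarrow> lt (expvec u') (expvec u)))"

definition lead_term ::
  "'n::finite zorder \<Rightarrow> ('n, 'k::zero) mpoly \<Rightarrow> ('n, 'k) mpoly" where
  "lead_term lt f =
     Poly_Mapping.single (lead_mon lt f) (Poly_Mapping.lookup f (lead_mon lt f))"

definition initial_ideal ::
  "'n::finite zorder \<Rightarrow> ('n, 'k::field) mpoly set \<Rightarrow> ('n, 'k) mpoly set" where
  "initial_ideal lt I = ideal_generated (lead_term lt ` (I - {0}))"

definition groebner_basis ::
  "'n::finite zorder \<Rightarrow> ('n, 'k::field) mpoly set \<Rightarrow> ('n, 'k) mpoly set \<Rightarrow> bool"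
  where
  "groebner_basis lt I G \<longleftrightarrow>
     finite G \<and> G \<subseteq> I \<and> 0 \<notin> G \<and> ideal_generated (lead_term lt ` G) = initial_ideal lt I"

definition reduced_groebner_basis ::
  "'n::finite zorder \<Rightarrow> ('n, 'k::field) mpoly set \<Rightarrow> ('n, 'k) mpoly set \<Rightarrow> bool"
  where
  "reduced_groebner_basis lt I G \<longleftrightarrow>
     groebner_basis lt I G \<and>
     (\<forall>f\<in>G. Poly_Mapping.lookup f (lead_mon lt f) = 1) \<and>
     (\<forall>f\<in>G. \<forall>g\<in>G - {f}. \<forall>u\<in>Poly_Mapping.keys f.
        \<not> lead_term lt g dvd Poly_Mapping.single u (Poly_Mapping.lookup f u))"


section \<open>The difference set of an ideal\<close>

definition partial_poly ::
  "'n::finite zorder \<Rightarrow> ('n, 'k::zero) mpoly \<Rightarrow> 'n rvec set" where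
  "partial_poly lt f =
     {expvec (lead_mon lt f) - expvec u' | u'. u' \<in> Poly_Mapping.keys f - {lead_mon lt f}}"

definition partial_set ::
  "'n::finite zorder \<Rightarrow> ('n, 'k::zero) mpoly set \<Rightarrow> 'n rvec set" where
  "partial_set lt G = (\<Union>f\<in>G. partial_poly lt f)"

definition partial_ideal :: "('n::finite, 'k::field) mpoly set \<Rightarrow> 'n rvec set" where
  "partial_ideal I = \<Union> {partial_set lt G | lt G. term_order lt \<and> reduced_groebner_basis lt I G}"


section \<open>Perturbation vectors representing the orders\<close>

definition M_set :: "('n::finite \<Rightarrow> 'n qvec) \<Rightarrow> ('n, 'k::field) mpoly set \<Rightarrow> 'n rvec set" where
  "M_set \<tau> I = {pairing (\<tau> i) u *\<^sub>R v | i u v. u \<in> partial_ideal I \<and> v \<in> partial_ideal I}"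

definition N_set ::
  "('n::{finite,linorder} \<Rightarrow> 'n qvec) \<Rightarrow> rat \<Rightarrow> ('n, 'k::field) mpoly set \<Rightarrow> 'n rvec set" where
  "N_set \<omega> \<delta> I = {pairing (perturb \<omega> \<delta>) u *\<^sub>R v | u v. u \<in> partial_ideal I \<and> v \<in> partial_ideal I}"

definition represents_on ::
  "('n::{finite,linorder} \<Rightarrow> 'n qvec) \<Rightarrow> rat \<Rightarrow> 'n rvec set \<Rightarrow> bool" where
  "represents_on \<omega> \<eta> S \<longleftrightarrow>
     (\<forall>u\<in>S. \<forall>v\<in>S. rat_order \<omega> u v \<longleftrightarrow> pairing (perturb \<omega> \<eta>) u < pairing (perturb \<omega> \<eta>) v)"

definition t_val ::
  "('n::{finite,linorder} \<Rightarrow> 'n qvec) \<Rightarrow> ('n \<Rightarrow> 'n qvec) \<Rightarrow> rat \<Rightarrow> rat \<Rightarrow> 'n rvec \<Rightarrow> real" where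
  "t_val \<omega> \<tau> \<delta> \<epsilon> v =
     pairing (perturb \<omega> \<delta>) v / (pairing (perturb \<omega> \<delta>) v - pairing (perturb \<tau> \<epsilon>) v)"

definition row_matrix :: "('n::finite \<Rightarrow> 'n qvec) \<Rightarrow> 'n rmat" where
  "row_matrix \<tau> = (\<chi> i. real_vec (\<tau> i))"

definition outer :: "'n::finite rvec \<Rightarrow> 'n rvec \<Rightarrow> 'n rmat" where
  "outer u v = (columnvector u :: real ^ 1 ^ 'n) ** (rowvector v :: real ^ 'n ^ 1)"

end

theory Submission
  imports Defs
begin

text \<open>
  Everything rests on the finiteness of \<open>\<partial>(I)\<close>. The reduced Groebner basis is determined by the
  set of leading monomials of \<open>I\<close> (\<open>reduced_groebner_basis_unique\<close>), and only finitely many such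
  sets arise as the term order varies, by Noetherian induction on monomial ideals
  (\<open>finite_lead_mons_above\<close>). Hence \<open>M\<^sub>\<tau>\<close> and \<open>N\<^sub>\<delta>\<close> are finite, and for small \<open>\<eta>\<close> the sign of
  \<open>\<langle>\<omega>\<^sub>\<eta>,x\<rangle>\<close>, a polynomial in \<open>\<eta>\<close>, is that of its lowest nonzero coefficient, which is what the
  lexicographic comparison looks at.

  For the comparison of parameters write \<open>A\<^sub>u = \<langle>\<omega>\<^sub>\<delta>,u\<rangle>\<close> and \<open>B\<^sub>u = \<langle>\<tau>\<^sub>\<epsilon>,u\<rangle>\<close>. Once \<open>B\<^sub>u < 0 < A\<^sub>u\<close> is known
  on the cone, \<open>t\<^sub>u < t\<^sub>v\<close> means \<open>A\<^sub>v B\<^sub>u < A\<^sub>u B\<^sub>v\<close>, hence \<open>A\<^sub>v u \<prec>\<^sub>2 A\<^sub>u v\<close> by (b). The latter compares the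
  numbers \<open>\<langle>\<tau>\<^sub>i,u\<rangle> A\<^sub>v = \<langle>\<omega>\<^sub>\<delta>, \<langle>\<tau>\<^sub>i,u\<rangle> v\<rangle>\<close> and \<open>\<langle>\<tau>\<^sub>i,v\<rangle> A\<^sub>u\<close> lexicographically, which by (a) is the
  comparison under \<open>\<prec>\<^sub>1\<close> of the rows \<open>\<langle>\<tau>\<^sub>i,u\<rangle> v\<^sup>t\<close> and \<open>\<langle>\<tau>\<^sub>i,v\<rangle> u\<^sup>t\<close> of the two matrices. Equality of the
  parameters forces \<open>A\<^sub>v u = A\<^sub>u v\<close>, as \<open>\<prec>\<^sub>2\<close> is total.

  The signs of \<open>A\<^sub>u\<close> and \<open>B\<^sub>u\<close> need care, because (a) and (b) speak only of products such as
  \<open>\<langle>\<tau>\<^sub>i,u'\<rangle> u\<close> and not of \<open>u\<close> itself. They follow as soon as two different scalars are available as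
  factors of \<open>u\<close> (\<open>represents_on_sign\<close>). For this one needs vectors in \<open>\<partial>(I)\<close> that are positive for
  \<open>\<prec>\<^sub>2\<close> and vectors that are negative for \<open>\<prec>\<^sub>1\<close>. Both exist when \<open>\<partial>(I)\<close> meets the cone: otherwise all
  term orders would have the same reduced Groebner basis, although the vector in the cone
  cannot come from the one over \<open>\<prec>\<^sub>2\<close> (\<open>partial_ideal_pos_exists\<close>, \<open>partial_ideal_neg_exists\<close>).
\<close>


section \<open>Divisibility of monomials and Dickson's lemma\<close>

abbreviation supp :: "('a, 'b::zero) poly_mapping \<Rightarrow> 'a set" where
  "supp \<equiv> Poly_Mapping.keys"

text \<open>Multiplication of monomials is addition of exponents, so this is divisibility.\<close>

definition mon_dvd :: "'n monomial \<Rightarrow> 'n monomial \<Rightarrow> bool" where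
  "mon_dvd s t \<longleftrightarrow> (\<exists>r. t = s + r)"

lemma mon_dvd_refl [simp]: "mon_dvd s s"
  unfolding mon_dvd_def by (rule exI[of _ 0]) simp

lemma mon_dvd_add [simp]: "mon_dvd s (s + r)"
  unfolding mon_dvd_def by blast

lemma mon_dvd_trans: "mon_dvd s t \<Longrightarrow> mon_dvd t r \<Longrightarrow> mon_dvd s r"
  unfolding mon_dvd_def by (metis add.assoc)

lemma mon_dvd_antisym:
  assumes "mon_dvd s t" "mon_dvd t s"
  shows "s = t"
proof (rule poly_mapping_eqI)
  obtain r r' where "t = s + r" "s = t + r'" using assms unfolding mon_dvd_def by blast
  then have *: "Poly_Mapping.lookup t i = Poly_Mapping.lookup s i + Poly_Mapping.lookup r i"
    and **: "Poly_Mapping.lookup s i = Poly_Mapping.lookup t i + Poly_Mapping.lookup r' i" for i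
    by (metis lookup_add)+
  show "Poly_Mapping.lookup s i = Poly_Mapping.lookup t i" for i
    using *[of i] **[of i] by linarith
qed

lemma mon_dvd_pointwise:
  assumes "\<And>i. Poly_Mapping.lookup s i \<le> Poly_Mapping.lookup t i"
  shows "mon_dvd s t"
proof -
  have "t = s + (t - s)"
    using assms by (intro poly_mapping_eqI) (simp add: lookup_add lookup_minus)
  then show ?thesis unfolding mon_dvd_def by blast
qed

lemma nat_seq_incseq_subseq:
  fixes s :: "nat \<Rightarrow> nat"
  shows "\<exists>\<phi>. strict_mono \<phi> \<and> incseq (\<lambda>n. s (\<phi> n))"
proof -
  obtain \<phi> where \<phi>: "strict_mono \<phi>" "monoseq (\<lambda>n. s (\<phi> n))"
    using seq_monosub[of s] by blast
  show ?thesis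
  proof (cases "incseq (\<lambda>n. s (\<phi> n))")
    case True
    with \<phi> show ?thesis by blast
  next
    case False
    with \<phi>(2) have dec: "decseq (\<lambda>n. s (\<phi> n))"
      by (simp add: monoseq_iff)
    \<comment> \<open>A weakly decreasing sequence of naturals is constant from the place where it attains its
       least value.\<close>
    define m where "m = (LEAST m. \<exists>n. s (\<phi> n) = m)"
    have "\<exists>n. s (\<phi> n) = m" unfolding m_def by (rule LeastI_ex) blast
    then obtain N where N: "s (\<phi> N) = m" by blast
    have "s (\<phi> (n + N)) = m" for n
    proof (rule antisym)
      show "s (\<phi> (n + N)) \<le> m" using decseqD[OF dec, of N "n + N"] N by simp
      show "m \<le> s (\<phi> (n + N))" unfolding m_def by (rule Least_le) blast
    qed
    moreover have "strict_mono (\<lambda>n. \<phi> (n + N))"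
      using \<phi>(1) by (simp add: strict_mono_def)
    ultimately show ?thesis by (intro exI[of _ "\<lambda>n. \<phi> (n + N)"]) (simp add: incseq_def)
  qed
qed

text \<open>
  Passing to subsequences, one variable after the other, makes all exponents weakly increasing
  simultaneously.
\<close>

lemma monomials_incseq_subseq:
  fixes m :: "nat \<Rightarrow> 'n monomial"
  assumes "finite A"
  shows "\<exists>\<phi>. strict_mono \<phi> \<and> (\<forall>i\<in>A. incseq (\<lambda>n. Poly_Mapping.lookup (m (\<phi> n)) i))"
  using assms
proof (induction A)
  case empty
  show ?case by (rule exI[of _ id]) (simp add: strict_mono_def)
next
  case (insert a A)
  then obtain \<phi> where \<phi>: "strict_mono \<phi>" "\<forall>i\<in>A. incseq (\<lambda>n. Poly_Mapping.lookup (m (\<phi> n)) i)"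
    by blast
  obtain \<psi> where \<psi>: "strict_mono \<psi>" "incseq (\<lambda>n. Poly_Mapping.lookup (m (\<phi> (\<psi> n))) a)"
    using nat_seq_incseq_subseq[of "\<lambda>n. Poly_Mapping.lookup (m (\<phi> n)) a"] by blast
  have "strict_mono (\<lambda>n. \<phi> (\<psi> n))"
    using \<phi>(1) \<psi>(1) by (simp add: strict_mono_def)
  moreover have "incseq (\<lambda>n. Poly_Mapping.lookup (m (\<phi> (\<psi> n))) i)" if "i \<in> A" for i
    using \<phi>(2) that \<psi>(1) unfolding incseq_def by (simp add: strict_mono_less_eq)
  ultimately show ?case using \<psi>(2) by (intro exI[of _ "\<lambda>n. \<phi> (\<psi> n)"]) auto
qed

lemma dickson:
  fixes m :: "nat \<Rightarrow> 'n::finite monomial"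
  shows "\<exists>i j. i < j \<and> mon_dvd (m i) (m j)"
proof -
  obtain \<phi> where \<phi>: "strict_mono \<phi>" "\<forall>i. incseq (\<lambda>n. Poly_Mapping.lookup (m (\<phi> n)) i)"
    using monomials_incseq_subseq[of "UNIV :: 'n set" m] by auto
  have "mon_dvd (m (\<phi> 0)) (m (\<phi> 1))"
    using \<phi>(2) by (intro mon_dvd_pointwise) (auto dest: incseqD)
  moreover have "\<phi> 0 < \<phi> 1" using \<phi>(1) by (simp add: strict_mono_def)
  ultimately show ?thesis by blast
qed

text \<open>An up-set of monomials is the set of monomials in a monomial ideal.\<close>

definition up_set :: "'n monomial set \<Rightarrow> bool" where
  "up_set J \<longleftrightarrow> (\<forall>s\<in>J. \<forall>t. mon_dvd s t \<longrightarrow> t \<in> J)"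

text \<open>
  Monomial ideals satisfy the ascending chain condition: a monomial that is new at some
  step of a chain is not divisible by those of earlier steps, contrary to Dickson's lemma.
\<close>

lemma wf_up_set_reverse_inclusion:
  "wf {(J', J). up_set (J :: 'n::finite monomial set) \<and> up_set J' \<and> J \<subset> J'}"
  unfolding wf_iff_no_infinite_down_chain
proof
  assume "\<exists>J. \<forall>i. (J (Suc i), J i) \<in> {(J', J). up_set (J :: 'n monomial set) \<and> up_set J' \<and> J \<subset> J'}"
  then obtain J :: "nat \<Rightarrow> 'n monomial set"
    where "\<forall>i. up_set (J i) \<and> up_set (J (Suc i)) \<and> J i \<subset> J (Suc i)" by auto
  then have up: "up_set (J i)" and lt: "J i \<subset> J (Suc i)" for i by auto
  have "\<forall>i. \<exists>m. m \<in> J (Suc i) - J i" using lt by blast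
  then obtain m where m: "\<And>i. m i \<in> J (Suc i) - J i" by metis
  obtain i j where ij: "i < j" "mon_dvd (m i) (m j)" using dickson[of m] by blast
  have "incseq J" using lt by (auto intro: incseq_SucI)
  then have "J (Suc i) \<subseteq> J j" using ij(1) incseqD[of J "Suc i" j] by simp
  then have "m i \<in> J j" using m by blast
  then have "m j \<in> J j" using up ij(2) unfolding up_set_def by blast
  then show False using m by blast
qed

lemma finite_antichain:
  fixes A :: "'n::finite monomial set"
  assumes "\<And>s t. s \<in> A \<Longrightarrow> t \<in> A \<Longrightarrow> mon_dvd s t \<Longrightarrow> s = t"
  shows "finite A"
proof (rule ccontr)
  assume "infinite A"
  then obtain f :: "nat \<Rightarrow> 'n monomial" where f: "inj f" "range f \<subseteq> A"
    using infinite_countable_subset by blast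
  obtain i j where "i < j" "mon_dvd (f i) (f j)" using dickson[of f] by blast
  then show False using assms[of "f i" "f j"] f by (auto dest: injD)
qed


section \<open>Term orders on monomials\<close>

definition mon_less :: "'n::finite zorder \<Rightarrow> 'n monomial \<Rightarrow> 'n monomial \<Rightarrow> bool" where
  "mon_less lt s t \<longleftrightarrow> lt (expvec s) (expvec t)"

lemma expvec_add: "expvec (s + t) = (expvec s + expvec t :: 'a::semiring_1 ^ 'n::finite)"
  by (simp add: expvec_def vec_eq_iff lookup_add)

lemma expvec_0 [simp]: "expvec 0 = (0 :: 'a::semiring_1 ^ 'n::finite)"
  by (simp add: expvec_def vec_eq_iff)

lemma expvec_inject [simp]:
  "(expvec s :: 'a::semiring_char_0 ^ 'n::finite) = expvec t \<longleftrightarrow> s = t"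
  by (auto simp: expvec_def vec_eq_iff intro: poly_mapping_eqI)

lemma monomial_induct_add:
  fixes s :: "'n::finite monomial"
  assumes "P 0" and "\<And>i n. P (Poly_Mapping.single i n)" and "\<And>s t. P s \<Longrightarrow> P t \<Longrightarrow> P (s + t)"
  shows "P s"
proof -
  have "P (\<Sum>i\<in>A. Poly_Mapping.single i (Poly_Mapping.lookup s i))" if "finite A" for A
    using that assms by (induction A) auto
  from this[of UNIV] have "P (\<Sum>i\<in>UNIV. Poly_Mapping.single i (Poly_Mapping.lookup s i))"
    by simp
  moreover have "(\<Sum>i\<in>UNIV. Poly_Mapping.single i (Poly_Mapping.lookup s i)) = s"
    by (intro poly_mapping_eqI) (simp add: lookup_sum lookup_single when_def)
  ultimately show ?thesis by simp
qed

context
  fixes lt :: "'n::finite zorder"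
  assumes to: "term_order lt"
begin

lemma mon_less_irrefl: "\<not> mon_less lt s s"
  using to unfolding term_order_def mon_less_def by blast

lemma mon_less_trans: "mon_less lt s t \<Longrightarrow> mon_less lt t r \<Longrightarrow> mon_less lt s r"
  using to unfolding term_order_def mon_less_def by blast

lemma mon_less_linear:
  assumes "s \<noteq> t"
  shows "mon_less lt s t \<or> mon_less lt t s"
proof -
  have "(expvec s :: int ^ 'n) \<noteq> expvec t" using assms by simp
  then show ?thesis using to unfolding term_order_def mon_less_def by simp
qed

lemma mon_less_add: "mon_less lt s t \<Longrightarrow> mon_less lt (r + s) (r + t)"
  using to unfolding term_order_def mon_less_def by (simp add: expvec_add add.commute[of "expvec r"])

lemma term_order_nonneg: "r = 0 \<or> mon_less lt 0 r"
proof -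
  have add: "s + t = 0 \<or> mon_less lt 0 (s + t)"
    if s: "s = 0 \<or> mon_less lt 0 s" and t: "t = 0 \<or> mon_less lt 0 t" for s t
    using s t mon_less_add[of 0 t s] mon_less_trans[of 0 s "s + t"] by auto
  have "expvec (Poly_Mapping.single i 1) = (axis i 1 :: int ^ 'n)" for i
    by (simp add: expvec_def vec_eq_iff axis_def lookup_single when_def)
  then have var: "mon_less lt 0 (Poly_Mapping.single i 1)" for i
    using to unfolding term_order_def mon_less_def by simp
  have pow: "Poly_Mapping.single i n = 0 \<or> mon_less lt 0 (Poly_Mapping.single i n)" for i n
  proof (induction n)
    case (Suc n)
    have "Poly_Mapping.single i (Suc n) = Poly_Mapping.single i n + Poly_Mapping.single i 1"
      by (simp flip: single_add)
    then show ?case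
      using add[OF Suc disjI2[OF var]] by simp
  qed simp
  show ?thesis
  proof (rule monomial_induct_add[where P = "\<lambda>r. r = 0 \<or> mon_less lt 0 r"])
    show "0 = 0 \<or> mon_less lt 0 0" by simp
  qed (fact pow add)+
qed

lemma mon_dvd_imp_le:
  assumes "mon_dvd s t"
  shows "s = t \<or> mon_less lt s t"
proof -
  obtain r where "t = s + r" using assms unfolding mon_dvd_def by blast
  then show ?thesis using term_order_nonneg[of r] mon_less_add[of 0 r s] by auto
qed

lemma mon_less_not_dvd: "mon_less lt s t \<Longrightarrow> \<not> mon_dvd t s"
  using mon_dvd_imp_le[of t s] mon_less_irrefl[of s] mon_less_trans[of s t s] by auto

text \<open>
  In an infinite descending sequence some term would divide a later, hence smaller, one by Dickson's
  lemma, but divisors are never larger.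
\<close>

lemma wf_mon_less: "wf {(s, t). mon_less lt s t}"
  unfolding wf_iff_no_infinite_down_chain
proof
  assume "\<exists>m. \<forall>i. (m (Suc i), m i) \<in> {(s, t). mon_less lt s t}"
  then obtain m where m: "\<And>i. mon_less lt (m (Suc i)) (m i)" by auto
  have desc: "i < j \<Longrightarrow> mon_less lt (m j) (m i)" for i j
    by (induction j) (use m mon_less_trans in \<open>auto simp: less_Suc_eq\<close>)
  obtain i j where "i < j" "mon_dvd (m i) (m j)" using dickson[of m] by blast
  then show False using desc mon_less_not_dvd by blast
qed

lemma mon_greatest_exists:
  assumes "finite A" "A \<noteq> {}"
  shows "\<exists>u\<in>A. \<forall>u'\<in>A. u' \<noteq> u \<longrightarrow> mon_less lt u' u"
  using assms
proof (induction A rule: finite_ne_induct)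
  case (insert x A)
  then obtain u where u: "u \<in> A" "\<And>u'. u' \<in> A \<Longrightarrow> u' \<noteq> u \<Longrightarrow> mon_less lt u' u" by blast
  show ?case
  proof (cases "mon_less lt x u")
    case True
    with u show ?thesis by auto
  next
    case False
    moreover have "x \<noteq> u" using u insert.hyps by blast
    ultimately have "mon_less lt u x" using mon_less_linear by blast
    then have "mon_less lt u' x" if "u' \<in> A" for u'
      using that u(2) mon_less_trans by blast
    then show ?thesis by auto
  qed
qed auto

lemma lead_mon_eqI:
  assumes "u \<in> supp f" and "\<And>u'. u' \<in> supp f \<Longrightarrow> u' \<noteq> u \<Longrightarrow> mon_less lt u' u"
  shows "lead_mon lt f = u"
  unfolding lead_mon_def
proof (rule the_equality)
  fix v assume v: "v \<in> supp f \<and> (\<forall>u'\<in>supp f. u' \<noteq> v \<longrightarrow> lt (expvec u') (expvec v))"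
  show "v = u"
  proof (rule ccontr)
    assume "v \<noteq> u"
    then have "mon_less lt v u" "mon_less lt u v"
      using assms v unfolding mon_less_def by auto
    then show False using mon_less_irrefl mon_less_trans by blast
  qed
qed (use assms in \<open>auto simp: mon_less_def\<close>)

lemma
  fixes f :: "('n, 'k::zero) mpoly"
  assumes "f \<noteq> 0"
  shows lead_mon_in_supp: "lead_mon lt f \<in> supp f"
    and lead_mon_greatest: "\<And>u. u \<in> supp f \<Longrightarrow> u \<noteq> lead_mon lt f \<Longrightarrow> mon_less lt u (lead_mon lt f)"
proof -
  have "supp f \<noteq> {}" using assms by (metis ex_in_conv in_keys_iff lookup_zero poly_mapping_eqI)
  then obtain u where u: "u \<in> supp f" "\<And>u'. u' \<in> supp f \<Longrightarrow> u' \<noteq> u \<Longrightarrow> mon_less lt u' u"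
    using mon_greatest_exists[of "supp f"] by auto
  moreover have "lead_mon lt f = u" using u by (rule lead_mon_eqI)
  ultimately show "lead_mon lt f \<in> supp f"
    and "\<And>u. u \<in> supp f \<Longrightarrow> u \<noteq> lead_mon lt f \<Longrightarrow> mon_less lt u (lead_mon lt f)"
    by auto
qed

end


section \<open>Ideals and their leading monomials\<close>

lemma module_times: "module ((*) :: 'a::comm_ring_1 \<Rightarrow> 'a \<Rightarrow> 'a)"
  by unfold_locales (simp_all add: algebra_simps)

context
  fixes I :: "'a::comm_ring_1 set"
  assumes ideal: "is_ideal I"
begin

lemma ideal_0: "0 \<in> I"
  using ideal unfolding is_ideal_def module.subspace_def[OF module_times] by blast

lemma ideal_add: "f \<in> I \<Longrightarrow> g \<in> I \<Longrightarrow> f + g \<in> I"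
  using ideal unfolding is_ideal_def module.subspace_def[OF module_times] by blast

lemma ideal_times: "f \<in> I \<Longrightarrow> h * f \<in> I"
  using ideal unfolding is_ideal_def module.subspace_def[OF module_times] by blast

lemma ideal_diff: "f \<in> I \<Longrightarrow> g \<in> I \<Longrightarrow> f - g \<in> I"
  using ideal_add[of f "- g"] ideal_times[of g "- 1"] by simp

end

lemma lookup_single_times_add:
  fixes f :: "('n, 'k::comm_ring_1) mpoly"
  shows "Poly_Mapping.lookup (Poly_Mapping.single t c * f) (t + k) = c * Poly_Mapping.lookup f k"
  by (simp add: lookup_mult lookup_single when_mult)

lemma supp_single_times:
  fixes f :: "('n, 'k::comm_ring_1) mpoly"
  shows "supp (Poly_Mapping.single t c * f) \<subseteq> (+) t ` supp f"
  using keys_mult[of "Poly_Mapping.single t c" f] by (auto split: if_splits)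

lemma poly_eq_sum_terms:
  fixes f :: "('n, 'k::comm_ring_1) mpoly"
  shows "f = (\<Sum>u\<in>supp f. Poly_Mapping.single u (Poly_Mapping.lookup f u))"
proof (rule poly_mapping_eqI)
  fix k
  have "Poly_Mapping.lookup (\<Sum>u\<in>supp f. Poly_Mapping.single u (Poly_Mapping.lookup f u)) k =
        (\<Sum>u\<in>supp f. if k = u then Poly_Mapping.lookup f u else 0)"
    unfolding lookup_sum by (intro sum.cong) (auto simp: lookup_single when_def)
  also have "\<dots> = Poly_Mapping.lookup f k"
    by (simp add: in_keys_iff)
  finally show "Poly_Mapping.lookup f k =
    Poly_Mapping.lookup (\<Sum>u\<in>supp f. Poly_Mapping.single u (Poly_Mapping.lookup f u)) k" ..
qed

definition lead_mons ::
  "'n::finite zorder \<Rightarrow> ('n, 'k::zero) mpoly set \<Rightarrow> 'n monomial set" where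
  "lead_mons lt I = lead_mon lt ` (I - {0})"

lemma lead_mon_in_lead_mons: "f \<in> I \<Longrightarrow> f \<noteq> 0 \<Longrightarrow> lead_mon lt f \<in> lead_mons lt I"
  unfolding lead_mons_def by blast

lemma up_set_lead_mons:
  fixes I :: "('n::finite, 'k::field) mpoly set"
  assumes to: "term_order lt" and ideal: "is_ideal I"
  shows "up_set (lead_mons lt I)"
  unfolding up_set_def
proof (intro ballI allI impI)
  fix s t assume "s \<in> lead_mons lt I" "mon_dvd s t"
  then obtain f r where f: "f \<in> I" "f \<noteq> 0" "s = lead_mon lt f" "t = s + r"
    unfolding lead_mons_def mon_dvd_def by auto
  define g where "g = Poly_Mapping.single r 1 * f"
  have "g \<in> I" unfolding g_def using ideal f(1) by (rule ideal_times)
  have "Poly_Mapping.lookup g (r + s) \<noteq> 0"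
    using lead_mon_in_supp[OF to f(2)] f(3) unfolding g_def lookup_single_times_add
    by (simp add: in_keys_iff)
  then have t: "t \<in> supp g" using f(4) by (simp add: in_keys_iff add.commute)
  have "lead_mon lt g = t"
  proof (rule lead_mon_eqI[OF to t])
    fix u assume u: "u \<in> supp g" "u \<noteq> t"
    then obtain k where k: "k \<in> supp f" "u = r + k"
      using supp_single_times[of r 1 f] unfolding g_def by auto
    with u f have "k \<noteq> s" by (auto simp: add.commute)
    then have "mon_less lt k s" using lead_mon_greatest[OF to f(2)] k f(3) by blast
    then show "mon_less lt u t" using mon_less_add[OF to, of k s r] k f(4) by (simp add: add.commute)
  qed
  moreover have "g \<noteq> 0" using t by auto
  ultimately show "t \<in> lead_mons lt I" using \<open>g \<in> I\<close> unfolding lead_mons_def by blast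
qed

text \<open>
  Division with remainder: a leading monomial is rewritten modulo the ideal into smaller ones,
  and the process ends because term orders are well-founded.
\<close>

lemma normal_form_exists:
  fixes I :: "('n::finite, 'k::field) mpoly set"
  assumes to: "term_order lt" and ideal: "is_ideal I"
  shows "\<exists>g. f - g \<in> I \<and> supp g \<inter> lead_mons lt I = {}"
proof -
  define P where "P f \<longleftrightarrow> (\<exists>g. f - g \<in> I \<and> supp g \<inter> lead_mons lt I = {})" for f
  have P_ideal: "P f" if "f \<in> I" for f
    unfolding P_def by (rule exI[of _ 0]) (use that in simp)
  have P_add: "P (f + f')" if f: "P f" and f': "P f'" for f f'
  proof -
    obtain g where g: "f - g \<in> I" "supp g \<inter> lead_mons lt I = {}"
      using f unfolding P_def by blast
    obtain g' where g': "f' - g' \<in> I" "supp g' \<inter> lead_mons lt I = {}"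
      using f' unfolding P_def by blast
    have "f + f' - (g + g') \<in> I"
      using ideal_add[OF ideal g(1) g'(1)] by (simp add: add_diff_add)
    moreover have "supp (g + g') \<inter> lead_mons lt I = {}"
      using keys_add[of g g'] g(2) g'(2) by blast
    ultimately show ?thesis unfolding P_def by blast
  qed
  have P_sum: "P (\<Sum>a\<in>A. h a)" if "finite A" "\<And>a. a \<in> A \<Longrightarrow> P (h a)"
    for A :: "'n monomial set" and h
    using that
  proof (induction A)
    case empty
    show ?case using P_ideal ideal_0[OF ideal] by simp
  next
    case (insert a A)
    then show ?case using P_add by simp
  qed
  have P_terms: "P f" if "\<And>u c. u \<in> supp f \<Longrightarrow> P (Poly_Mapping.single u c)" for f
    using P_sum[of "supp f" "\<lambda>u. Poly_Mapping.single u (Poly_Mapping.lookup f u)"] that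
    by (simp flip: poly_eq_sum_terms)
  have P_term: "P (Poly_Mapping.single m c)" for m c
  proof (induction m arbitrary: c rule: wf_induct_rule[OF wf_mon_less[OF to]])
    case (1 m)
    show ?case
    proof (cases "m \<in> lead_mons lt I")
      case False
      then have "supp (Poly_Mapping.single m c) \<inter> lead_mons lt I = {}" by simp
      then show ?thesis
        unfolding P_def using ideal_0[OF ideal] by (intro exI[of _ "Poly_Mapping.single m c"]) simp
    next
      case True
      then obtain h where h: "h \<in> I" "h \<noteq> 0" "m = lead_mon lt h" unfolding lead_mons_def by blast
      define a where "a = Poly_Mapping.lookup h m"
      have "a \<noteq> 0" using lead_mon_in_supp[OF to h(2)] h(3) by (simp add: a_def in_keys_iff)
      define q where "q = Poly_Mapping.single 0 (c / a) * h"
      have q: "Poly_Mapping.lookup q k = c / a * Poly_Mapping.lookup h k" for k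
        using lookup_single_times_add[of 0 "c / a" h k] unfolding q_def by simp
      define r where "r = Poly_Mapping.single m c - q"
      have "P r"
      proof (rule P_terms)
        fix u b assume u: "u \<in> supp r"
        have "Poly_Mapping.lookup r m = 0"
          using \<open>a \<noteq> 0\<close> by (simp add: r_def lookup_minus q flip: a_def)
        with u have "u \<noteq> m" by (auto simp: in_keys_iff)
        with u have "u \<in> supp h"
          by (auto simp: in_keys_iff r_def lookup_minus q lookup_single when_def)
        with \<open>u \<noteq> m\<close> have "mon_less lt u m" using lead_mon_greatest[OF to h(2)] h(3) by blast
        then show "P (Poly_Mapping.single u b)" using 1 by simp
      qed
      moreover have "P q" unfolding q_def using P_ideal ideal_times[OF ideal h(1)] by blast
      ultimately have "P (r + q)" by (rule P_add)
      then show ?thesis by (simp add: r_def)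
    qed
  qed
  have "P f" by (rule P_terms) (rule P_term)
  then show ?thesis unfolding P_def .
qed

text \<open>
  The elements of the reduced Groebner basis are of this form, with a minimal leading monomial.
  Note that the conditions on the polynomial depend on the order only through the set of leading
  monomials.
\<close>

lemma reduced_element_exists:
  fixes I :: "('n::finite, 'k::field) mpoly set"
  assumes to: "term_order lt" and ideal: "is_ideal I" and m: "m \<in> lead_mons lt I"
  shows "\<exists>p\<in>I. Poly_Mapping.lookup p m = 1 \<and> supp p \<inter> lead_mons lt I = {m}"
proof -
  obtain g where g: "Poly_Mapping.single m 1 - g \<in> I" "supp g \<inter> lead_mons lt I = {}"
    using normal_form_exists[OF to ideal] by blast
  let ?p = "Poly_Mapping.single m 1 - g"
  have "m \<notin> supp g" using g(2) m by blast
  then have 1: "Poly_Mapping.lookup ?p m = 1" by (simp add: lookup_minus in_keys_iff)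
  have "supp ?p \<subseteq> insert m (supp g)"
    by (auto simp: in_keys_iff lookup_minus lookup_single when_def split: if_splits)
  then have "supp ?p \<inter> lead_mons lt I = {m}"
    using g(2) m 1 by (auto simp: in_keys_iff)
  with g(1) 1 show ?thesis by blast
qed

lemma lead_mon_of_reduced_element:
  assumes to: "term_order lt" and "p \<in> I" and "supp p \<inter> lead_mons lt I = {m}"
  shows "lead_mon lt p = m"
proof -
  have "p \<noteq> 0" using assms(3) by auto
  then have "lead_mon lt p \<in> supp p \<inter> lead_mons lt I"
    using lead_mon_in_supp[OF to] lead_mon_in_lead_mons assms(2) by blast
  with assms(3) show ?thesis by simp
qed

text \<open>
  The monomials outside the set of leading monomials form a basis modulo the ideal, whence there
  are no proper inclusions between these sets for different orders.
\<close>

lemma lead_mons_subset_imp_eq: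
  fixes I :: "('n::finite, 'k::field) mpoly set"
  assumes to: "term_order lt" "term_order lt'" and ideal: "is_ideal I"
    and sub: "lead_mons lt I \<subseteq> lead_mons lt' I"
  shows "lead_mons lt I = lead_mons lt' I"
proof (rule equalityI[OF sub subsetI])
  fix m assume "m \<in> lead_mons lt' I"
  then obtain p where p: "p \<in> I" "supp p \<inter> lead_mons lt' I = {m}"
    using reduced_element_exists[OF to(2) ideal] by blast
  then have "p \<noteq> 0" by auto
  then have "lead_mon lt p \<in> supp p \<inter> lead_mons lt I"
    using lead_mon_in_supp[OF to(1)] lead_mon_in_lead_mons p(1) by blast
  with sub p(2) show "m \<in> lead_mons lt I" by auto
qed

text \<open>
  An ideal has only finitely many initial ideals. If \<open>J\<close> is properly contained in one set of
  leading monomials, then some nonzero polynomial of the ideal has no monomial in \<open>J\<close>. Its leading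
  monomial, one of finitely many, then enlarges \<open>J\<close> for every order, so that the claim follows by
  Noetherian induction on \<open>J\<close>.
\<close>

lemma finite_lead_mons_above:
  fixes I :: "('n::finite, 'k::field) mpoly set"
  assumes ideal: "is_ideal I" and "up_set J"
  shows "finite {L. J \<subseteq> L \<and> (\<exists>lt. term_order lt \<and> L = lead_mons lt I)}"
  using assms(2)
proof (induction J rule: wf_induct_rule[OF wf_up_set_reverse_inclusion])
  case (1 J)
  let ?A = "\<lambda>J. {L. J \<subseteq> L \<and> (\<exists>lt. term_order lt \<and> L = lead_mons lt I)}"
  show ?case
  proof (cases "\<exists>lt. term_order lt \<and> J \<subset> lead_mons lt I")
    case False
    then have "?A J \<subseteq> {J}" by blast
    then show ?thesis using finite_subset by blast
  next
    case True
    then obtain lt m where lt: "term_order lt" "J \<subset> lead_mons lt I" "m \<in> lead_mons lt I - J"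
      by blast
    then obtain p where p: "p \<in> I" "supp p \<inter> lead_mons lt I = {m}"
      using reduced_element_exists[OF _ ideal, of lt m] by blast
    then have "p \<noteq> 0" by auto
    have new: "supp p \<inter> J = {}" using p(2) lt(2,3) by auto
    define J' where "J' u = J \<union> {t. mon_dvd u t}" for u
    have up: "up_set (J' u)" for u
      using "1.prems" mon_dvd_trans unfolding J'_def up_set_def by blast
    have fin: "finite (?A (J' u))" if "u \<in> supp p" for u
    proof (rule "1.IH"[OF _ up])
      have "u \<in> J' u - J" using that new unfolding J'_def by auto
      then show "(J' u, J) \<in> {(J', J). up_set J \<and> up_set J' \<and> J \<subset> J'}"
        using up "1.prems" unfolding J'_def by blast
    qed
    have "?A J \<subseteq> (\<Union>u\<in>supp p. ?A (J' u))"
    proof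
      fix L assume "L \<in> ?A J"
      then obtain lt' where lt': "term_order lt'" "L = lead_mons lt' I" "J \<subseteq> L" by blast
      have "lead_mon lt' p \<in> supp p" using lead_mon_in_supp[OF lt'(1) \<open>p \<noteq> 0\<close>] .
      moreover have "lead_mon lt' p \<in> L"
        using lead_mon_in_lead_mons p(1) \<open>p \<noteq> 0\<close> lt'(2) by blast
      then have "J' (lead_mon lt' p) \<subseteq> L"
        using lt' up_set_lead_mons[OF lt'(1) ideal] unfolding J'_def up_set_def by blast
      ultimately show "L \<in> (\<Union>u\<in>supp p. ?A (J' u))" using lt' by blast
    qed
    then show ?thesis by (rule finite_subset) (simp add: fin)
  qed
qed

lemma finite_lead_mons:
  fixes I :: "('n::finite, 'k::field) mpoly set"
  assumes "is_ideal I"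
  shows "finite {lead_mons lt I | lt. term_order lt}"
proof -
  have "finite {L. {} \<subseteq> L \<and> (\<exists>lt. term_order lt \<and> L = lead_mons lt I)}"
    using assms by (rule finite_lead_mons_above) (simp add: up_set_def)
  then show ?thesis by (rule rev_finite_subset) blast
qed


section \<open>Reduced Groebner bases\<close>

lemma supp_lead_term:
  fixes f :: "('n::finite, 'k::zero) mpoly"
  assumes "term_order lt" "f \<noteq> 0"
  shows "supp (lead_term lt f) = {lead_mon lt f}"
  using lead_mon_in_supp[OF assms] unfolding lead_term_def by (simp add: in_keys_iff)

text \<open>
  Polynomials all of whose monomials are divisible by monomials from \<open>S\<close> form an ideal that
  contains \<open>S\<close>.
\<close>

lemma supp_ideal_generated:
  fixes S :: "('n, 'k::comm_ring_1) mpoly set"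
  assumes "f \<in> ideal_generated S" "u \<in> supp f"
  shows "\<exists>s\<in>S. \<exists>v\<in>supp s. mon_dvd v u"
proof -
  let ?D = "{f :: ('n, 'k) mpoly. \<forall>u\<in>supp f. \<exists>s\<in>S. \<exists>v\<in>supp s. mon_dvd v u}"
  have "module.subspace (*) ?D"
    unfolding module.subspace_def[OF module_times]
  proof (intro conjI ballI allI)
    fix g h assume "g \<in> ?D" "h \<in> ?D"
    then show "g + h \<in> ?D" using keys_add[of g h] by blast
  next
    fix c :: "('n, 'k) mpoly" and g assume g: "g \<in> ?D"
    have "\<exists>s\<in>S. \<exists>v\<in>supp s. mon_dvd v u" if "u \<in> supp (c * g)" for u
    proof -
      obtain a b where ab: "u = a + b" "b \<in> supp g" using \<open>u \<in> supp (c * g)\<close> keys_mult[of c g] by blast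
      then obtain s v where "s \<in> S" "v \<in> supp s" "mon_dvd v b" using g by blast
      moreover have "mon_dvd b u" using mon_dvd_add[of b a] ab(1) by (simp add: add.commute)
      ultimately show ?thesis using mon_dvd_trans by blast
    qed
    then show "c * g \<in> ?D" by blast
  qed simp
  moreover have "S \<subseteq> ?D" using mon_dvd_refl by blast
  ultimately have "ideal_generated S \<subseteq> ?D"
    unfolding ideal_generated_def by (intro module.span_minimal[OF module_times])
  with assms show ?thesis by blast
qed

lemma groebner_basis_lead_mon_dvd:
  fixes I :: "('n::finite, 'k::field) mpoly set"
  assumes to: "term_order lt" and G: "groebner_basis lt I G" and m: "m \<in> lead_mons lt I"
  shows "\<exists>g\<in>G. mon_dvd (lead_mon lt g) m"
proof -
  obtain f where f: "f \<in> I" "f \<noteq> 0" "m = lead_mon lt f" using m unfolding lead_mons_def by blast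
  have "lead_term lt f \<in> initial_ideal lt I"
    unfolding initial_ideal_def ideal_generated_def
    using f by (intro module.span_base[OF module_times]) auto
  then have "lead_term lt f \<in> ideal_generated (lead_term lt ` G)"
    using G unfolding groebner_basis_def by simp
  moreover have "m \<in> supp (lead_term lt f)" using supp_lead_term[OF to f(2)] f(3) by simp
  ultimately obtain g v where g: "g \<in> G" "v \<in> supp (lead_term lt g)" "mon_dvd v m"
    using supp_ideal_generated by blast
  have "g \<noteq> 0" using g(1) G unfolding groebner_basis_def by blast
  then have "v = lead_mon lt g" using supp_lead_term[OF to] g(2) by blast
  with g show ?thesis by blast
qed

lemma mon_dvd_imp_single_dvd:
  assumes "mon_dvd s t"
  shows "Poly_Mapping.single s 1 dvd (Poly_Mapping.single t c :: ('n, 'k::comm_ring_1) mpoly)"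
proof -
  obtain r where "t = s + r" using assms unfolding mon_dvd_def by blast
  then have "Poly_Mapping.single t c = Poly_Mapping.single s 1 * (Poly_Mapping.single r c :: ('n, 'k) mpoly)"
    by (simp add: mult_single)
  then show ?thesis by (rule dvdI)
qed

lemma single_dvd_imp_mon_dvd:
  assumes "Poly_Mapping.single s 1 dvd (Poly_Mapping.single t c :: ('n, 'k::comm_ring_1) mpoly)"
    and "c \<noteq> 0"
  shows "mon_dvd s t"
proof -
  obtain q where q: "Poly_Mapping.single t c = Poly_Mapping.single s 1 * (q :: ('n, 'k) mpoly)"
    using assms(1) by (rule dvdE)
  have "t \<in> supp (Poly_Mapping.single t c)" using assms(2) by simp
  then have "t \<in> (+) s ` supp q" unfolding q using supp_single_times by blast
  then show ?thesis by auto
qed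

context
  fixes lt :: "'n::finite zorder" and I G :: "('n, 'k::field) mpoly set"
  assumes to: "term_order lt" and G: "reduced_groebner_basis lt I G"
begin

lemma reduced_groebner_basisD:
  assumes "f \<in> G"
  shows "f \<in> I" "f \<noteq> 0" "Poly_Mapping.lookup f (lead_mon lt f) = 1"
  using G assms unfolding reduced_groebner_basis_def groebner_basis_def by auto

lemma reduced_groebner_basis_lead_term:
  "f \<in> G \<Longrightarrow> lead_term lt f = Poly_Mapping.single (lead_mon lt f) 1"
  using reduced_groebner_basisD unfolding lead_term_def by simp

lemma reduced_groebner_basis_not_dvd:
  assumes "f \<in> G" "g \<in> G" "u \<in> supp f" "mon_dvd (lead_mon lt g) u"
  shows "g = f"
proof (rule ccontr)
  assume "g \<noteq> f"
  then have "\<not> lead_term lt g dvd Poly_Mapping.single u (Poly_Mapping.lookup f u)"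
    using G assms unfolding reduced_groebner_basis_def by blast
  then show False
    unfolding reduced_groebner_basis_lead_term[OF assms(2)]
    using mon_dvd_imp_single_dvd[OF assms(4)] by blast
qed

lemma reduced_groebner_basis_lead_mon_dvd:
  "m \<in> lead_mons lt I \<Longrightarrow> \<exists>g\<in>G. mon_dvd (lead_mon lt g) m"
  using groebner_basis_lead_mon_dvd[OF to] G unfolding reduced_groebner_basis_def by blast

lemma reduced_groebner_basis_supp_lead_mons:
  assumes f: "f \<in> G"
  shows "supp f \<inter> lead_mons lt I = {lead_mon lt f}"
proof
  show "{lead_mon lt f} \<subseteq> supp f \<inter> lead_mons lt I"
    using lead_mon_in_supp[OF to] lead_mon_in_lead_mons reduced_groebner_basisD[OF f] by blast
  show "supp f \<inter> lead_mons lt I \<subseteq> {lead_mon lt f}"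
  proof
    fix u assume u: "u \<in> supp f \<inter> lead_mons lt I"
    then obtain g where g: "g \<in> G" "mon_dvd (lead_mon lt g) u"
      using reduced_groebner_basis_lead_mon_dvd by blast
    then have "g = f" using reduced_groebner_basis_not_dvd[OF f] u by blast
    then have "\<not> mon_less lt u (lead_mon lt f)" using g(2) mon_less_not_dvd[OF to] by blast
    then show "u \<in> {lead_mon lt f}"
      using lead_mon_greatest[OF to reduced_groebner_basisD(2)[OF f]] u by blast
  qed
qed

end

text \<open>
  The reduced Groebner basis depends on the term order only through the set of leading monomials:
  two candidates for the element with a given leading monomial differ by an element of the ideal
  that has no leading monomial in its support.
\<close>

lemma reduced_groebner_basis_unique:
  fixes I :: "('n::finite, 'k::field) mpoly set"
  assumes to: "term_order lt" "term_order lt'" and ideal: "is_ideal I"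
    and G: "reduced_groebner_basis lt I G" "reduced_groebner_basis lt' I G'"
    and eq: "lead_mons lt I = lead_mons lt' I" and f: "f \<in> G"
  shows "f \<in> G' \<and> lead_mon lt' f = lead_mon lt f"
proof -
  note fG = reduced_groebner_basisD[OF to(1) G(1) f]
  let ?m = "lead_mon lt f"
  have m: "supp f \<inter> lead_mons lt I = {?m}"
    using reduced_groebner_basis_supp_lead_mons[OF to(1) G(1) f] .
  then obtain f' where f': "f' \<in> G'" "mon_dvd (lead_mon lt' f') ?m"
    using reduced_groebner_basis_lead_mon_dvd[OF to(2) G(2)] eq by blast
  note fG' = reduced_groebner_basisD[OF to(2) G(2) f'(1)]
  have m': "supp f' \<inter> lead_mons lt I = {lead_mon lt' f'}"
    using reduced_groebner_basis_supp_lead_mons[OF to(2) G(2) f'(1)] eq by simp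
  then obtain g where g: "g \<in> G" "mon_dvd (lead_mon lt g) (lead_mon lt' f')"
    using reduced_groebner_basis_lead_mon_dvd[OF to(1) G(1)] by blast
  have "g = f"
    using reduced_groebner_basis_not_dvd[OF to(1) G(1) f g(1)] mon_dvd_trans[OF g(2) f'(2)] m
    by blast
  then have lm: "lead_mon lt' f' = ?m" using g(2) f'(2) mon_dvd_antisym by blast
  have "supp (f' - f) \<inter> lead_mons lt I = {}"
  proof (rule ccontr)
    assume "supp (f' - f) \<inter> lead_mons lt I \<noteq> {}"
    then obtain u where u: "u \<in> supp (f' - f)" "u \<in> lead_mons lt I" by blast
    then have "u \<in> supp f' \<or> u \<in> supp f" by (auto simp: in_keys_iff lookup_minus)
    then have "u \<in> (supp f' \<inter> lead_mons lt I) \<union> (supp f \<inter> lead_mons lt I)"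
      using u(2) by blast
    then have "u = ?m" unfolding m m' lm by simp
    then show False using u(1) fG(3) fG'(3) lm by (simp add: in_keys_iff lookup_minus)
  qed
  moreover have "f' - f \<in> I" using ideal_diff[OF ideal fG'(1) fG(1)] .
  ultimately have "f' - f = 0"
    using lead_mon_in_supp[OF to(1), of "f' - f"] lead_mon_in_lead_mons[of "f' - f" I lt] by blast
  then have "f' = f" by simp
  with f'(1) lm show ?thesis by simp
qed

lemma partial_set_cong:
  fixes I :: "('n::finite, 'k::field) mpoly set"
  assumes "term_order lt" "term_order lt'" "is_ideal I"
    and "reduced_groebner_basis lt I G" "reduced_groebner_basis lt' I G'"
    and "lead_mons lt I = lead_mons lt' I"
  shows "partial_set lt G = partial_set lt' G'"
proof
  have "partial_poly lt f \<subseteq> partial_set lt' G'" if "f \<in> G" for f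
    using reduced_groebner_basis_unique[OF assms that] unfolding partial_set_def partial_poly_def
    by auto
  then show "partial_set lt G \<subseteq> partial_set lt' G'" unfolding partial_set_def by blast
  have "partial_poly lt' f \<subseteq> partial_set lt G" if "f \<in> G'" for f
    using reduced_groebner_basis_unique[OF assms(2,1,3,5,4) assms(6)[symmetric] that]
    unfolding partial_set_def partial_poly_def by auto
  then show "partial_set lt' G' \<subseteq> partial_set lt G" unfolding partial_set_def by blast
qed

lemma finite_partial_set:
  fixes G :: "('n::finite, 'k::field) mpoly set"
  assumes "reduced_groebner_basis lt I G"
  shows "finite (partial_set lt G)"
proof -
  have "partial_poly lt f =
      (\<lambda>u'. expvec (lead_mon lt f) - expvec u') ` (supp f - {lead_mon lt f})" for f :: "('n, 'k) mpoly"
    unfolding partial_poly_def by auto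
  then have "finite (partial_poly lt f)" for f :: "('n, 'k) mpoly" by simp
  moreover have "finite G"
    using assms unfolding reduced_groebner_basis_def groebner_basis_def by blast
  ultimately show ?thesis unfolding partial_set_def by blast
qed

text \<open>
  Sending a set of leading monomials to the differences contributed by the corresponding reduced
  Groebner basis is well-defined, so there are only finitely many contributions, each of them finite.
\<close>

theorem finite_partial_ideal:
  fixes I :: "('n::finite, 'k::field) mpoly set"
  assumes ideal: "is_ideal I"
  shows "finite (partial_ideal I)"
proof -
  define \<D> where "\<D> = {partial_set lt G | lt G. term_order lt \<and> reduced_groebner_basis lt I G}"
  define P where
    "P L X \<longleftrightarrow> (\<exists>lt G. term_order lt \<and> reduced_groebner_basis lt I G \<and>
       L = lead_mons lt I \<and> X = partial_set lt G)" for L X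
  have uniq: "X = Y" if "P L X" "P L Y" for L X Y
    using that partial_set_cong[OF _ _ ideal] unfolding P_def by metis
  have "\<D> \<subseteq> (\<lambda>L. THE X. P L X) ` {lead_mons lt I | lt. term_order lt}"
  proof
    fix X assume "X \<in> \<D>"
    then obtain lt where "term_order lt" and X: "P (lead_mons lt I) X"
      unfolding \<D>_def P_def by blast
    moreover have "(THE X. P (lead_mons lt I) X) = X" using X uniq[OF _ X] by (rule the_equality)
    ultimately show "X \<in> (\<lambda>L. THE X. P L X) ` {lead_mons lt I | lt. term_order lt}"
      by (intro rev_image_eqI[of "lead_mons lt I"]) auto
  qed
  then have "finite \<D>" using finite_lead_mons[OF ideal] by (rule finite_surj[rotated])
  moreover have "finite X" if "X \<in> \<D>" for X
    using that finite_partial_set unfolding \<D>_def by blast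
  ultimately show ?thesis unfolding partial_ideal_def \<D>_def[symmetric] by blast
qed

text \<open>
  One fully reduced polynomial is chosen for each minimal leading monomial; by Dickson's lemma there
  are finitely many of these.
\<close>

theorem reduced_groebner_basis_exists:
  fixes I :: "('n::finite, 'k::field) mpoly set"
  assumes to: "term_order lt" and ideal: "is_ideal I"
  shows "\<exists>G. reduced_groebner_basis lt I G"
proof -
  define L where "L = lead_mons lt I"
  define Min where "Min = {m \<in> L. \<forall>s\<in>L. mon_dvd s m \<longrightarrow> s = m}"
  have "finite Min" by (rule finite_antichain) (auto simp: Min_def)
  have Min_dvd: "\<exists>m\<in>Min. mon_dvd m t" if "t \<in> L" for t
    using that
  proof (induction t rule: wf_induct_rule[OF wf_mon_less[OF to]])
    case (1 t)
    show ?case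
    proof (cases "t \<in> Min")
      case False
      then obtain s where s: "s \<in> L" "mon_dvd s t" "s \<noteq> t" using 1 unfolding Min_def by blast
      then have "mon_less lt s t" using mon_dvd_imp_le[OF to] by blast
      then obtain m where "m \<in> Min" "mon_dvd m s" using 1 s by auto
      with s show ?thesis using mon_dvd_trans by blast
    qed (use mon_dvd_refl in blast)
  qed
  have "\<forall>m\<in>Min. \<exists>p. p \<in> I \<and> Poly_Mapping.lookup p m = 1 \<and> supp p \<inter> L = {m}"
    using reduced_element_exists[OF to ideal] unfolding Min_def L_def by blast
  then obtain p where p: "\<And>m. m \<in> Min \<Longrightarrow> p m \<in> I"
    "\<And>m. m \<in> Min \<Longrightarrow> Poly_Mapping.lookup (p m) m = 1" "\<And>m. m \<in> Min \<Longrightarrow> supp (p m) \<inter> L = {m}"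
    by metis
  have lead: "lead_mon lt (p m) = m" if "m \<in> Min" for m
    using lead_mon_of_reduced_element[OF to p(1)[OF that]] p(3)[OF that] unfolding L_def by blast
  have nz: "p m \<noteq> 0" if "m \<in> Min" for m using p(3)[OF that] by auto
  have lterm: "lead_term lt (p m) = Poly_Mapping.single m 1" if "m \<in> Min" for m
    unfolding lead_term_def using lead[OF that] p(2)[OF that] by simp
  let ?G = "p ` Min"
  have "ideal_generated (lead_term lt ` ?G) = initial_ideal lt I"
  proof
    show "ideal_generated (lead_term lt ` ?G) \<subseteq> initial_ideal lt I"
      unfolding initial_ideal_def ideal_generated_def
      using p(1) nz by (intro module.span_mono[OF module_times]) auto
    have "lead_term lt f \<in> ideal_generated (lead_term lt ` ?G)" if f: "f \<in> I - {0}" for f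
    proof -
      have "lead_mon lt f \<in> L" using f lead_mon_in_lead_mons unfolding L_def by blast
      then obtain m where m: "m \<in> Min" "mon_dvd m (lead_mon lt f)" using Min_dvd by blast
      have "lead_term lt (p m) dvd lead_term lt f"
        unfolding lterm[OF m(1)] unfolding lead_term_def using m(2) by (rule mon_dvd_imp_single_dvd)
      then obtain q where q: "lead_term lt f = q * lead_term lt (p m)"
        by (metis dvdE mult.commute)
      show ?thesis
        unfolding q ideal_generated_def using m(1)
        by (intro module.span_scale[OF module_times] module.span_base[OF module_times]) auto
    qed
    then show "initial_ideal lt I \<subseteq> ideal_generated (lead_term lt ` ?G)"
      unfolding initial_ideal_def ideal_generated_def
      by (intro module.span_minimal[OF module_times] module.subspace_span[OF module_times]) auto
  qed
  then have "groebner_basis lt I ?G"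
    unfolding groebner_basis_def using \<open>finite Min\<close> p(1) nz by auto
  moreover have "\<not> lead_term lt (p m') dvd Poly_Mapping.single u (Poly_Mapping.lookup (p m) u)"
    if m: "m \<in> Min" "m' \<in> Min" "p m' \<noteq> p m" and u: "u \<in> supp (p m)" for m m' u
  proof
    assume "lead_term lt (p m') dvd Poly_Mapping.single u (Poly_Mapping.lookup (p m) u)"
    then have dvd: "mon_dvd m' u"
      unfolding lterm[OF m(2)] using u by (auto simp: in_keys_iff dest: single_dvd_imp_mon_dvd)
    have "m' \<in> L" using m(2) unfolding Min_def by blast
    then have "u \<in> L" using up_set_lead_mons[OF to ideal] dvd unfolding L_def up_set_def by blast
    then have "u = m" using p(3)[OF m(1)] u by blast
    then have "m' = m" using m(1) dvd \<open>m' \<in> L\<close> unfolding Min_def by blast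
    with m(3) show False by simp
  qed
  ultimately have "reduced_groebner_basis lt I ?G"
    unfolding reduced_groebner_basis_def using p(2) lead by auto
  then show ?thesis by blast
qed

text \<open>
  The hypothesis yields an inclusion between the two sets of leading monomials, which is then an
  equality, so that the two reduced Groebner bases coincide.
\<close>

lemma partial_set_eq_if_lead_mon_eq:
  fixes I :: "('n::finite, 'k::field) mpoly set"
  assumes to: "term_order lt" "term_order lt'" and ideal: "is_ideal I"
    and G: "reduced_groebner_basis lt I G" "reduced_groebner_basis lt' I G'"
    and lead: "\<And>f. f \<in> G \<Longrightarrow> lead_mon lt' f = lead_mon lt f"
  shows "partial_set lt G = partial_set lt' G'"
proof -
  have "lead_mons lt I \<subseteq> lead_mons lt' I"
  proof
    fix m assume "m \<in> lead_mons lt I"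
    then obtain g where g: "g \<in> G" "mon_dvd (lead_mon lt g) m"
      using reduced_groebner_basis_lead_mon_dvd[OF to(1) G(1)] by blast
    have "lead_mon lt' g \<in> lead_mons lt' I"
      using reduced_groebner_basisD[OF to(1) G(1) g(1)] by (intro lead_mon_in_lead_mons)
    then show "m \<in> lead_mons lt' I"
      using up_set_lead_mons[OF to(2) ideal] g lead unfolding up_set_def by auto
  qed
  then show ?thesis
    using partial_set_cong[OF to ideal G] lead_mons_subset_imp_eq[OF to ideal] by blast
qed

section \<open>Rational group orders\<close>

lemma pairing_sum_right: "pairing w x = (\<Sum>k\<in>UNIV. of_rat (w $ k) * x $ k)"
  by (simp add: pairing_def real_vec_def inner_vec_def)

lemma pairing_zero_right [simp]: "pairing w 0 = 0"
  by (simp add: pairing_def)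

lemma pairing_minus_right [simp]: "pairing w (- x) = - pairing w x"
  by (simp add: pairing_def)

lemma pairing_diff_right: "pairing w (x - y) = pairing w x - pairing w y"
  by (simp add: pairing_def inner_diff_right)

lemma pairing_scaleR_right [simp]: "pairing w (c *\<^sub>R x) = c * pairing w x"
  by (simp add: pairing_def)

lemma pairing_add_left: "pairing (v + w) x = pairing v x + pairing w x"
  by (simp add: pairing_sum_right of_rat_add distrib_right sum.distrib)

lemma pairing_scale_left: "pairing (c *s w) x = of_rat c * pairing w x"
  by (simp add: pairing_sum_right of_rat_mult sum_distrib_left mult.assoc)

lemma pairing_zero_left [simp]: "pairing 0 x = 0"
  by (simp add: pairing_sum_right)

lemma pairing_sum_left: "pairing (\<Sum>i\<in>A. f i) x = (\<Sum>i\<in>A. pairing (f i) x)"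
  by (induction A rule: infinite_finite_induct) (simp_all add: pairing_add_left)

lemma rat_order_iff:
  "rat_order \<omega> u v \<longleftrightarrow>
     (\<exists>i. pairing (\<omega> i) u < pairing (\<omega> i) v \<and> (\<forall>j<i. pairing (\<omega> j) u = pairing (\<omega> j) v))"
  by (simp add: rat_order_def lex_less_def)

lemma rat_order_diff: "rat_order \<omega> u v \<longleftrightarrow> rat_order \<omega> 0 (v - u)"
proof -
  have "pairing (\<omega> j) 0 < pairing (\<omega> j) (v - u) \<longleftrightarrow> pairing (\<omega> j) u < pairing (\<omega> j) v"
    and "pairing (\<omega> j) 0 = pairing (\<omega> j) (v - u) \<longleftrightarrow> pairing (\<omega> j) u = pairing (\<omega> j) v" for j
    by (auto simp: pairing_diff_right)
  then show ?thesis unfolding rat_order_iff by simp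
qed

lemma rat_order_scaleR: "0 < c \<Longrightarrow> rat_order \<omega> 0 (c *\<^sub>R x) \<longleftrightarrow> rat_order \<omega> 0 x"
  by (simp add: rat_order_iff zero_less_mult_iff)

lemma rat_order_irrefl: "\<not> rat_order \<omega> u u"
  by (simp add: rat_order_iff)

lemma rat_order_trans:
  assumes "rat_order \<omega> u v" "rat_order \<omega> v w"
  shows "rat_order \<omega> u w"
proof -
  obtain i where i: "pairing (\<omega> i) u < pairing (\<omega> i) v" "\<forall>j<i. pairing (\<omega> j) u = pairing (\<omega> j) v"
    using assms(1) unfolding rat_order_iff by blast
  obtain k where k: "pairing (\<omega> k) v < pairing (\<omega> k) w" "\<forall>j<k. pairing (\<omega> j) v = pairing (\<omega> j) w"
    using assms(2) unfolding rat_order_iff by blast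
  have "pairing (\<omega> (min i k)) u < pairing (\<omega> (min i k)) w"
    by (cases i k rule: linorder_cases) (use i k in \<open>auto simp: min_def\<close>)
  moreover have "\<forall>j<min i k. pairing (\<omega> j) u = pairing (\<omega> j) w" using i(2) k(2) by simp
  ultimately show ?thesis unfolding rat_order_iff by blast
qed

text \<open>A basis of \<open>\<rat>\<^sup>n\<close> still spans \<open>\<real>\<^sup>n\<close> over the reals.\<close>

lemma pairing_basis_eq_0:
  assumes "is_rat_basis \<omega>" and "\<And>i. pairing (\<omega> i) x = 0"
  shows "x = 0"
proof -
  have "pairing w x = 0" if "w \<in> vec.span (range \<omega>)" for w
    using that
    by (induction rule: vec.span_induct_alt) (auto simp: pairing_add_left pairing_scale_left assms(2))
  then have *: "pairing w x = 0" for w using assms(1) unfolding is_rat_basis_def by simp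
  have "x $ k = 0" for k
  proof -
    have "pairing (axis k 1) x = (\<Sum>j\<in>UNIV. if j = k then x $ j else 0)"
      unfolding pairing_sum_right by (intro sum.cong) (auto simp: axis_def)
    then show ?thesis using * by simp
  qed
  then show ?thesis by (simp add: vec_eq_iff)
qed

lemma rat_order_cases:
  "rat_order \<omega> u v \<or> rat_order \<omega> v u \<or> (\<forall>i. pairing (\<omega> i) u = pairing (\<omega> i) v)"
proof (cases "\<forall>i. pairing (\<omega> i) u = pairing (\<omega> i) v")
  case False
  let ?D = "{i. pairing (\<omega> i) u \<noteq> pairing (\<omega> i) v}"
  have ne: "?D \<noteq> {}" using False by blast
  define i where "i = Min ?D"
  have "i \<in> ?D" unfolding i_def using ne by (intro Min_in) auto
  moreover have "\<forall>j<i. pairing (\<omega> j) u = pairing (\<omega> j) v"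
    unfolding i_def using ne by (auto simp: Min_gr_iff dest: leD)
  ultimately show ?thesis
    unfolding rat_order_iff by (metis (mono_tags) linorder_neqE mem_Collect_eq)
qed blast

lemma rat_order_linear:
  assumes "is_rat_basis \<omega>" "u \<noteq> v"
  shows "rat_order \<omega> u v \<or> rat_order \<omega> v u"
proof -
  have "\<exists>i. pairing (\<omega> i) (u - v) \<noteq> 0"
    using pairing_basis_eq_0[OF assms(1), of "u - v"] assms(2) by auto
  then show ?thesis using rat_order_cases[of \<omega> u v] by (auto simp: pairing_diff_right)
qed

definition int_order :: "('n::{finite,linorder} \<Rightarrow> 'n qvec) \<Rightarrow> 'n zorder" where
  "int_order \<omega> u v \<longleftrightarrow> rat_order \<omega> (\<chi> i. of_int (u $ i)) (\<chi> i. of_int (v $ i))"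

lemma term_order_int_order:
  fixes \<omega> :: "'n::{finite,linorder} \<Rightarrow> 'n qvec"
  assumes "rat_term_order \<omega>"
  shows "term_order (int_order \<omega>)"
  unfolding term_order_def
proof (intro conjI allI impI)
  let ?r = "\<lambda>u :: (int, 'n) vec. (\<chi> i. of_int (u $ i)) :: 'n rvec"
  show "\<not> int_order \<omega> u u" for u by (simp add: int_order_def rat_order_irrefl)
  show "int_order \<omega> u w" if "int_order \<omega> u v" "int_order \<omega> v w" for u v w
    using that rat_order_trans unfolding int_order_def by blast
  show "int_order \<omega> u v \<or> int_order \<omega> v u" if "u \<noteq> v" for u v
  proof -
    have "?r u \<noteq> ?r v" using that by (simp add: vec_eq_iff)
    then show ?thesis
      using rat_order_linear assms unfolding int_order_def rat_term_order_def by blast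
  qed
  show "int_order \<omega> (u + w) (v + w)" if "int_order \<omega> u v" for u v w
  proof -
    have *: "?r (v + w) - ?r (u + w) = ?r v - ?r u" by (simp add: vec_eq_iff)
    have "rat_order \<omega> 0 (?r v - ?r u)"
      using that unfolding int_order_def rat_order_diff[of \<omega> "?r u"] .
    then show ?thesis unfolding int_order_def rat_order_diff[of \<omega> "?r (u + w)"] * .
  qed
  show "int_order \<omega> 0 (axis i 1)" for i
  proof -
    have "?r (axis i 1) = axis i 1" "?r 0 = 0" by (auto simp: vec_eq_iff axis_def)
    then show ?thesis using assms unfolding int_order_def rat_term_order_def by simp
  qed
qed

lemma mon_less_int_order:
  fixes \<omega> :: "'n::{finite,linorder} \<Rightarrow> 'n qvec"
  shows
  "mon_less (int_order \<omega>) s t \<longleftrightarrow> rat_order \<omega> 0 (expvec t - expvec s)"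
proof -
  have "(\<chi> i. of_int (expvec s $ i)) = (expvec s :: 'n rvec)" for s :: "'n monomial"
    by (simp add: expvec_def vec_eq_iff)
  then show ?thesis unfolding mon_less_def int_order_def
    by (subst rat_order_diff) simp
qed


section \<open>Replacing a rational order by a single vector\<close>

lemma pairing_perturb:
  "pairing (perturb \<omega> \<eta>) x = (\<Sum>i\<in>UNIV. of_rat \<eta> ^ card {j. j < i} * pairing (\<omega> i) x)"
  by (simp add: perturb_def pairing_sum_left pairing_scale_left of_rat_power)

text \<open>
  After division by the lowest power of \<open>d\<close> that occurs, the sum tends to \<open>c i\<close>.
\<close>

lemma eventually_polynomial_pos:
  fixes c :: "'n::{finite,linorder} \<Rightarrow> real"
  assumes i: "0 < c i" "\<forall>j<i. c j = 0"
  shows "\<forall>\<^sub>F d in at_right 0. 0 < (\<Sum>j\<in>UNIV. d ^ card {k. k < j} * c j)"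
proof -
  let ?k = "\<lambda>j::'n. card {k. k < j}"
  define g where "g d = (\<Sum>j\<in>{i..}. d ^ (?k j - ?k i) * c j)" for d
  have mono: "?k i \<le> ?k j" if "i \<le> j" for j
    using that by (intro card_mono) auto
  have strict: "?k i < ?k j" if "i < j" for j
    using that by (intro psubset_card_mono) auto
  have split: "(\<Sum>j\<in>UNIV. d ^ ?k j * c j) = d ^ ?k i * g d" for d
  proof -
    have "(\<Sum>j\<in>UNIV. d ^ ?k j * c j) = (\<Sum>j\<in>{i..}. d ^ ?k j * c j)"
      using i(2) by (intro sum.mono_neutral_right) auto
    also have "\<dots> = (\<Sum>j\<in>{i..}. d ^ ?k i * (d ^ (?k j - ?k i) * c j))"
      using mono by (intro sum.cong) (auto simp: mult.assoc simp flip: power_add)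
    finally show ?thesis by (simp add: g_def sum_distrib_left)
  qed
  have "g 0 = (\<Sum>j\<in>{i..}. if j = i then c i else 0)"
    unfolding g_def
  proof (intro sum.cong refl)
    fix j assume "j \<in> {i..}"
    then consider "j = i" | "i < j" by fastforce
    then have "j \<noteq> i \<Longrightarrow> ?k j - ?k i \<noteq> 0" using strict[of j] by cases simp_all
    then show "0 ^ (?k j - ?k i) * c j = (if j = i then c i else 0)"
      by (auto simp: power_0_left)
  qed
  then have "g 0 = c i" by simp
  moreover have "(g \<longlongrightarrow> g 0) (at_right 0)"
    unfolding g_def by (intro tendsto_intros)
  ultimately have "\<forall>\<^sub>F d in at_right 0. 0 < g d"
    using i(1) by (auto intro: order_tendstoD)
  moreover have "\<forall>\<^sub>F d in at_right 0. (0::real) < d"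
    by (rule eventually_at_right_less)
  ultimately show ?thesis
    unfolding split by eventually_elim simp
qed

lemma eventually_polynomial_sign:
  fixes \<omega> :: "'n::{finite,linorder} \<Rightarrow> 'n qvec"
  shows "\<forall>\<^sub>F d in at_right 0.
    rat_order \<omega> u v \<longleftrightarrow> 0 < (\<Sum>i\<in>UNIV. d ^ card {k. k < i} * pairing (\<omega> i) (v - u))"
proof -
  let ?p = "\<lambda>x d. \<Sum>i\<in>UNIV. d ^ card {k. k < i} * pairing (\<omega> i) x"
  have pos: "\<forall>\<^sub>F d in at_right 0. 0 < ?p x d" if "rat_order \<omega> 0 x" for x
    using that eventually_polynomial_pos[of "\<lambda>i. pairing (\<omega> i) x"] by (auto simp: rat_order_iff)
  have neg: "?p (u - v) d = - ?p (v - u) d" for d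
    by (simp add: pairing_diff_right right_diff_distrib sum_subtractf)
  consider "rat_order \<omega> u v" | "rat_order \<omega> v u" | "\<forall>i. pairing (\<omega> i) u = pairing (\<omega> i) v"
    using rat_order_cases by blast
  then show ?thesis
  proof cases
    case 1
    then have "\<forall>\<^sub>F d in at_right 0. 0 < ?p (v - u) d"
      using pos by (simp flip: rat_order_diff)
    then show ?thesis using 1 by simp
  next
    case 2
    then have "\<forall>\<^sub>F d in at_right 0. 0 < ?p (u - v) d"
      using pos by (simp flip: rat_order_diff)
    moreover have "\<not> rat_order \<omega> u v" using 2 rat_order_trans rat_order_irrefl by blast
    ultimately show ?thesis unfolding neg by (auto elim: eventually_mono)
  next
    case 3
    then show ?thesis by (simp add: pairing_diff_right rat_order_iff)
  qed
qed

lemma represents_on_exists: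
  fixes \<omega> :: "'n::{finite,linorder} \<Rightarrow> 'n qvec"
  assumes "finite S"
  shows "\<exists>\<delta>>0. represents_on \<omega> \<delta> S"
proof -
  let ?p = "\<lambda>d x. \<Sum>i\<in>UNIV. d ^ card {k. k < i} * pairing (\<omega> i) x"
  have "\<forall>\<^sub>F d in at_right 0. \<forall>u\<in>S. \<forall>v\<in>S. rat_order \<omega> u v \<longleftrightarrow> 0 < ?p d (v - u)"
    using assms by (intro eventually_ball_finite ballI eventually_polynomial_sign) auto
  then obtain b :: real where b: "0 < b"
    "\<And>d. 0 < d \<Longrightarrow> d < b \<Longrightarrow> \<forall>u\<in>S. \<forall>v\<in>S. rat_order \<omega> u v \<longleftrightarrow> 0 < ?p d (v - u)"
    unfolding eventually_at_right_field by blast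
  obtain \<delta> :: rat where \<delta>: "0 < real_of_rat \<delta>" "real_of_rat \<delta> < b"
    using of_rat_dense[OF b(1)] by auto
  then have "represents_on \<omega> \<delta> S"
    unfolding represents_on_def using b(2)[OF \<delta>]
    unfolding pairing_perturb[symmetric] by (simp add: pairing_diff_right)
  then show ?thesis using \<delta>(1) by (intro exI[of _ \<delta>]) simp
qed

text \<open>
  The sets on which the orders are represented contain products of scalars with vectors only. Two
  multiples of a vector by different scalars suffice to recover the sign of the vector itself.
\<close>

lemma represents_on_sign:
  assumes rep: "represents_on \<omega> \<eta> S" and S: "a *\<^sub>R x \<in> S" "b *\<^sub>R x \<in> S" and ab: "a < b"
  shows "0 < pairing (perturb \<omega> \<eta>) x \<longleftrightarrow> rat_order \<omega> 0 x"
    and "pairing (perturb \<omega> \<eta>) x < 0 \<longleftrightarrow> rat_order \<omega> x 0"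
proof -
  have *: "b *\<^sub>R x - a *\<^sub>R x = (b - a) *\<^sub>R x" "a *\<^sub>R x - b *\<^sub>R x = (b - a) *\<^sub>R (- x)"
    by (simp_all add: algebra_simps)
  have "rat_order \<omega> 0 x \<longleftrightarrow> rat_order \<omega> (a *\<^sub>R x) (b *\<^sub>R x)"
    unfolding rat_order_diff[of \<omega> "a *\<^sub>R x"] * using ab by (simp add: rat_order_scaleR)
  also have "\<dots> \<longleftrightarrow> a * pairing (perturb \<omega> \<eta>) x < b * pairing (perturb \<omega> \<eta>) x"
    using rep S unfolding represents_on_def by simp
  finally show "0 < pairing (perturb \<omega> \<eta>) x \<longleftrightarrow> rat_order \<omega> 0 x"
    using ab by (auto simp: mult_less_cancel_right)
  have "rat_order \<omega> x 0 \<longleftrightarrow> rat_order \<omega> (b *\<^sub>R x) (a *\<^sub>R x)"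
    unfolding rat_order_diff[of \<omega> "b *\<^sub>R x"] rat_order_diff[of \<omega> x] *
    using ab rat_order_scaleR[of "b - a" \<omega> "- x"] by simp
  also have "\<dots> \<longleftrightarrow> b * pairing (perturb \<omega> \<eta>) x < a * pairing (perturb \<omega> \<eta>) x"
    using rep S unfolding represents_on_def by simp
  finally show "pairing (perturb \<omega> \<eta>) x < 0 \<longleftrightarrow> rat_order \<omega> x 0"
    using ab by (auto simp: mult_less_cancel_right)
qed


section \<open>Vectors of both signs in the difference set\<close>

lemma partial_set_int_order_pos:
  fixes I :: "('n::{finite,linorder}, 'k::field) mpoly set"
  assumes "rat_term_order \<omega>" "reduced_groebner_basis (int_order \<omega>) I G"
    and "w \<in> partial_set (int_order \<omega>) G"
  shows "rat_order \<omega> 0 w"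
proof -
  note to = term_order_int_order[OF assms(1)]
  obtain f u where f: "f \<in> G" "u \<in> supp f" "u \<noteq> lead_mon (int_order \<omega>) f"
    and w: "w = expvec (lead_mon (int_order \<omega>) f) - expvec u"
    using assms(3) unfolding partial_set_def partial_poly_def by blast
  have "mon_less (int_order \<omega>) u (lead_mon (int_order \<omega>) f)"
    using lead_mon_greatest[OF to reduced_groebner_basisD(2)[OF to assms(2) f(1)] f(2,3)] .
  then show ?thesis unfolding w mon_less_int_order .
qed

text \<open>
  Positivity of the differences for \<open>\<omega>\<close> means that passing from the order \<open>lt\<close> to the one given by
  \<open>\<omega>\<close> does not change the leading monomials of the basis.
\<close>

lemma partial_set_eq_if_pos:
  fixes I :: "('n::{finite,linorder}, 'k::field) mpoly set"
  assumes to: "term_order lt" and \<omega>: "rat_term_order \<omega>" and ideal: "is_ideal I"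
    and G: "reduced_groebner_basis lt I G" "reduced_groebner_basis (int_order \<omega>) I G'"
    and pos: "\<And>w. w \<in> partial_set lt G \<Longrightarrow> rat_order \<omega> 0 w"
  shows "partial_set lt G = partial_set (int_order \<omega>) G'"
proof (rule partial_set_eq_if_lead_mon_eq[OF to term_order_int_order[OF \<omega>] ideal G])
  fix f assume f: "f \<in> G"
  show "lead_mon (int_order \<omega>) f = lead_mon lt f"
  proof (rule lead_mon_eqI[OF term_order_int_order[OF \<omega>]])
    show "lead_mon lt f \<in> supp f"
      using lead_mon_in_supp[OF to reduced_groebner_basisD(2)[OF to G(1) f]] .
    fix u assume "u \<in> supp f" "u \<noteq> lead_mon lt f"
    then have "expvec (lead_mon lt f) - expvec u \<in> partial_set lt G"
      using f unfolding partial_set_def partial_poly_def by blast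
    then show "mon_less (int_order \<omega>) u (lead_mon lt f)"
      unfolding mon_less_int_order by (rule pos)
  qed
qed

text \<open>
  A vector that is negative for \<open>\<prec>\<close> is not contributed by the reduced Groebner basis over \<open>\<prec>\<close>.
  If the latter contributed no vector at all, then it would consist of monomials, and would be the
  only reduced Groebner basis.
\<close>

lemma partial_ideal_pos_exists:
  fixes I :: "('n::{finite,linorder}, 'k::field) mpoly set"
  assumes ideal: "is_ideal I" and \<tau>: "rat_term_order \<tau>"
    and u: "u \<in> partial_ideal I" "rat_order \<tau> u 0"
  shows "\<exists>w\<in>partial_ideal I. rat_order \<tau> 0 w"
proof -
  note to = term_order_int_order[OF \<tau>]
  obtain G where G: "reduced_groebner_basis (int_order \<tau>) I G"
    using reduced_groebner_basis_exists[OF to ideal] by blast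
  obtain lt H where lt: "term_order lt" and H: "reduced_groebner_basis lt I H" "u \<in> partial_set lt H"
    using u(1) unfolding partial_ideal_def by blast
  have "partial_set (int_order \<tau>) G \<noteq> {}"
  proof
    assume empty: "partial_set (int_order \<tau>) G = {}"
    have "partial_set (int_order \<tau>) G = partial_set lt H"
    proof (rule partial_set_eq_if_lead_mon_eq[OF to lt ideal G H(1)])
      fix f assume f: "f \<in> G"
      have f0: "f \<noteq> 0" using reduced_groebner_basisD(2)[OF to G f] .
      have "supp f \<subseteq> {lead_mon (int_order \<tau>) f}"
        using empty f unfolding partial_set_def partial_poly_def by blast
      then show "lead_mon lt f = lead_mon (int_order \<tau>) f" using lead_mon_in_supp[OF lt f0] by blast
    qed
    with empty H(2) show False by simp
  qed
  then obtain w where w: "w \<in> partial_set (int_order \<tau>) G" by blast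
  then have "w \<in> partial_ideal I" using to G unfolding partial_ideal_def by blast
  then show ?thesis using partial_set_int_order_pos[OF \<tau> G w] by blast
qed

text \<open>
  If all vectors were positive for the first order, then its reduced Groebner basis would be the
  only one. It would therefore also be the one for the second order, for which the vector in the
  cone is negative.
\<close>

lemma partial_ideal_neg_exists:
  fixes I :: "('n::{finite,linorder}, 'k::field) mpoly set"
  assumes ideal: "is_ideal I" and \<omega>: "rat_term_order \<omega>" and \<tau>: "rat_term_order \<tau>"
    and u: "u \<in> partial_ideal I" "rat_order \<tau> u 0"
  shows "\<exists>w\<in>partial_ideal I. rat_order \<omega> w 0"
proof (rule ccontr)
  assume no_neg: "\<not> ?thesis"
  note to = term_order_int_order[OF \<omega>] term_order_int_order[OF \<tau>]
  obtain G where G: "reduced_groebner_basis (int_order \<omega>) I G"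
    using reduced_groebner_basis_exists[OF to(1) ideal] by blast
  obtain G' where G': "reduced_groebner_basis (int_order \<tau>) I G'"
    using reduced_groebner_basis_exists[OF to(2) ideal] by blast
  obtain lt H where lt: "term_order lt" and H: "reduced_groebner_basis lt I H" "u \<in> partial_set lt H"
    using u(1) unfolding partial_ideal_def by blast
  have eq: "partial_set lt H = partial_set (int_order \<omega>) G"
    if lt: "term_order lt" and H: "reduced_groebner_basis lt I H" for lt H
  proof (rule partial_set_eq_if_pos[OF lt \<omega> ideal H G])
    fix w assume w: "w \<in> partial_set lt H"
    then have "w \<in> partial_ideal I" using lt H unfolding partial_ideal_def by blast
    then have "\<not> rat_order \<omega> w 0" using no_neg by blast
    moreover have "w \<noteq> 0"
      using w unfolding partial_set_def partial_poly_def by auto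
    ultimately show "rat_order \<omega> 0 w"
      using rat_order_linear \<omega> unfolding rat_term_order_def by blast
  qed
  have "u \<in> partial_set (int_order \<tau>) G'" using H(2) eq[OF lt H(1)] eq[OF to(2) G'] by simp
  then have "rat_order \<tau> 0 u" by (rule partial_set_int_order_pos[OF \<tau> G'])
  with u(2) show False using rat_order_trans rat_order_irrefl by blast
qed


section \<open>Comparing the parameters\<close>

lemma row_matrix_outer: "(row_matrix \<tau> ** outer u v) $ i = pairing (\<tau> i) u *\<^sub>R v"
  by (simp add: vec_eq_iff row_matrix_def outer_def matrix_matrix_mult_def columnvector_def
      rowvector_def pairing_def inner_vec_def sum_distrib_right mult.assoc)

lemma ratio_compare:
  fixes A B A' B' :: real
  assumes "0 < A" "B < 0" "0 < A'" "B' < 0"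
  shows "A / (A - B) < A' / (A' - B') \<longleftrightarrow> A' * B < A * B'"
    and "A / (A - B) = A' / (A' - B') \<longleftrightarrow> A' * B = A * B'"
proof -
  have "0 < A - B" "0 < A' - B'" using assms by auto
  then show "A / (A - B) < A' / (A' - B') \<longleftrightarrow> A' * B < A * B'"
    and "A / (A - B) = A' / (A' - B') \<longleftrightarrow> A' * B = A * B'"
    by (auto simp: divide_simps algebra_simps)
qed

context
  fixes I :: "('n::{finite,linorder}, 'k::field) mpoly set"
    and \<omega> \<tau> :: "'n \<Rightarrow> 'n qvec" and \<delta> \<epsilon> :: rat
  assumes ideal: "is_ideal I" and \<omega>: "rat_term_order \<omega>" and \<tau>: "rat_term_order \<tau>"
    and rep_M: "represents_on \<omega> \<delta> (M_set \<tau> I)" and rep_N: "represents_on \<tau> \<epsilon> (N_set \<omega> \<delta> I)"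
begin

text \<open>
  The scalars \<open>\<langle>\<tau>\<^sub>i,u\<rangle> < 0 < \<langle>\<tau>\<^sub>j,w\<rangle>\<close>, with \<open>w\<close> positive for \<open>\<prec>\<^sub>2\<close>, show that \<open>\<omega>\<^sub>\<delta>\<close> has the sign of \<open>\<prec>\<^sub>1\<close>
  on all of \<open>\<partial>(I)\<close>. In turn the scalars \<open>\<langle>\<omega>\<^sub>\<delta>,z\<rangle> < 0 < \<langle>\<omega>\<^sub>\<delta>,u\<rangle>\<close>, with \<open>z\<close> negative for \<open>\<prec>\<^sub>1\<close>, settle the sign
  of \<open>\<langle>\<tau>\<^sub>\<epsilon>,u\<rangle>\<close>.
\<close>

lemma perturb_signs:
  assumes u: "u \<in> partial_ideal I \<inter> diff_cone (rat_order \<omega>) (rat_order \<tau>)"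
  shows "0 < pairing (perturb \<omega> \<delta>) u" and "pairing (perturb \<tau> \<epsilon>) u < 0"
proof -
  have u: "u \<in> partial_ideal I" "rat_order \<omega> 0 u" "rat_order \<tau> u 0"
    using u unfolding diff_cone_def by auto
  obtain i where i: "pairing (\<tau> i) u < 0" using u(3) unfolding rat_order_iff by auto
  obtain w where w: "w \<in> partial_ideal I" "rat_order \<tau> 0 w"
    using partial_ideal_pos_exists[OF ideal \<tau> u(1,3)] by blast
  obtain j where j: "0 < pairing (\<tau> j) w" using w(2) unfolding rat_order_iff by auto
  have M: "pairing (\<tau> i) u *\<^sub>R x \<in> M_set \<tau> I" "pairing (\<tau> j) w *\<^sub>R x \<in> M_set \<tau> I"
    if "x \<in> partial_ideal I" for x
    using u w that unfolding M_set_def by blast+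
  note sign_\<omega> = represents_on_sign[OF rep_M M order.strict_trans[OF i j]]
  show pos: "0 < pairing (perturb \<omega> \<delta>) u" using sign_\<omega>(1)[of u] u by blast
  obtain z where z: "z \<in> partial_ideal I" "rat_order \<omega> z 0"
    using partial_ideal_neg_exists[OF ideal \<omega> \<tau> u(1,3)] by blast
  then have neg: "pairing (perturb \<omega> \<delta>) z < 0" using sign_\<omega>(2)[of z] by blast
  have "pairing (perturb \<omega> \<delta>) z *\<^sub>R u \<in> N_set \<omega> \<delta> I" "pairing (perturb \<omega> \<delta>) u *\<^sub>R u \<in> N_set \<omega> \<delta> I"
    using u(1) z(1) unfolding N_set_def by blast+
  from represents_on_sign(2)[OF rep_N this order.strict_trans[OF neg pos]]
  show "pairing (perturb \<tau> \<epsilon>) u < 0" using u(3) by blast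
qed

lemma represents_on_N_compare:
  assumes "u \<in> partial_ideal I" "v \<in> partial_ideal I"
  shows "pairing (perturb \<omega> \<delta>) v * pairing (perturb \<tau> \<epsilon>) u <
           pairing (perturb \<omega> \<delta>) u * pairing (perturb \<tau> \<epsilon>) v \<longleftrightarrow>
         rat_order \<tau> (pairing (perturb \<omega> \<delta>) v *\<^sub>R u) (pairing (perturb \<omega> \<delta>) u *\<^sub>R v)"
proof -
  have "pairing (perturb \<omega> \<delta>) v *\<^sub>R u \<in> N_set \<omega> \<delta> I"
    "pairing (perturb \<omega> \<delta>) u *\<^sub>R v \<in> N_set \<omega> \<delta> I"
    using assms unfolding N_set_def by blast+
  then show ?thesis using rep_N unfolding represents_on_def by simp
qed

lemma represents_on_M_compare:
  assumes "u \<in> partial_ideal I" "v \<in> partial_ideal I"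
  shows "pairing (\<tau> i) u * pairing (perturb \<omega> \<delta>) v < pairing (\<tau> i) v * pairing (perturb \<omega> \<delta>) u \<longleftrightarrow>
         rat_order \<omega> (pairing (\<tau> i) u *\<^sub>R v) (pairing (\<tau> i) v *\<^sub>R u)"
proof -
  have "pairing (\<tau> i) u *\<^sub>R v \<in> M_set \<tau> I" "pairing (\<tau> i) v *\<^sub>R u \<in> M_set \<tau> I"
    using assms unfolding M_set_def by blast+
  then show ?thesis using rep_M unfolding represents_on_def by simp
qed

text \<open>
  Two vectors of \<open>M\<^sub>\<tau>\<close> on which \<open>\<omega>\<^sub>\<delta>\<close> agrees are incomparable for \<open>\<prec>\<^sub>1\<close>, hence equal, since \<open>\<prec>\<^sub>1\<close> is total
  on \<open>\<real>\<^sup>n\<close>.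
\<close>

lemma M_compare_eq:
  assumes uv: "u \<in> partial_ideal I" "v \<in> partial_ideal I"
  shows "pairing (\<tau> i) u * pairing (perturb \<omega> \<delta>) v = pairing (\<tau> i) v * pairing (perturb \<omega> \<delta>) u \<longleftrightarrow>
         pairing (\<tau> i) u *\<^sub>R v = pairing (\<tau> i) v *\<^sub>R u"
    (is "?lhs \<longleftrightarrow> ?rhs")
proof
  assume ?rhs
  then show ?lhs by (metis pairing_scaleR_right)
next
  assume eq: ?lhs
  show ?rhs
  proof (rule ccontr)
    assume "\<not> ?rhs"
    then have "rat_order \<omega> (pairing (\<tau> i) u *\<^sub>R v) (pairing (\<tau> i) v *\<^sub>R u) \<or>
      rat_order \<omega> (pairing (\<tau> i) v *\<^sub>R u) (pairing (\<tau> i) u *\<^sub>R v)"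
      using rat_order_linear \<omega> unfolding rat_term_order_def by blast
    then show False
      using represents_on_M_compare[OF uv, of i] represents_on_M_compare[OF uv(2,1), of i] eq by linarith
  qed
qed

text \<open>
  Both sides compare lexicographically over \<open>i\<close>: the left one, with \<open>A\<^sub>x = \<langle>\<omega>\<^sub>\<delta>,x\<rangle>\<close>, the
  numbers \<open>\<langle>\<tau>\<^sub>i,u\<rangle> A\<^sub>v\<close> and \<open>\<langle>\<tau>\<^sub>i,v\<rangle> A\<^sub>u\<close>,
  the right one the rows with these values under \<open>\<omega>\<^sub>\<delta>\<close>.
\<close>

lemma N_compare_iff_matrix_less:
  assumes uv: "u \<in> partial_ideal I" "v \<in> partial_ideal I"
  shows "rat_order \<tau> (pairing (perturb \<omega> \<delta>) v *\<^sub>R u) (pairing (perturb \<omega> \<delta>) u *\<^sub>R v) \<longleftrightarrow>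
    lex_less (rat_order \<omega>) (row_matrix \<tau> ** outer u v) (row_matrix \<tau> ** outer v u)"
  unfolding lex_less_def row_matrix_outer represents_on_M_compare[OF uv, symmetric]
    M_compare_eq[OF uv, symmetric]
  by (simp add: rat_order_iff mult.commute)

lemma t_val_less_iff:
  assumes u: "u \<in> partial_ideal I \<inter> diff_cone (rat_order \<omega>) (rat_order \<tau>)"
    and v: "v \<in> partial_ideal I \<inter> diff_cone (rat_order \<omega>) (rat_order \<tau>)"
  shows "t_val \<omega> \<tau> \<delta> \<epsilon> u < t_val \<omega> \<tau> \<delta> \<epsilon> v \<longleftrightarrow>
    lex_less (rat_order \<omega>) (row_matrix \<tau> ** outer u v) (row_matrix \<tau> ** outer v u)"
  unfolding t_val_def ratio_compare(1)[OF perturb_signs[OF u] perturb_signs[OF v]]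
  using represents_on_N_compare N_compare_iff_matrix_less u v by simp

lemma t_val_eq_imp_multiple:
  assumes u: "u \<in> partial_ideal I \<inter> diff_cone (rat_order \<omega>) (rat_order \<tau>)"
    and v: "v \<in> partial_ideal I \<inter> diff_cone (rat_order \<omega>) (rat_order \<tau>)"
    and eq: "t_val \<omega> \<tau> \<delta> \<epsilon> u = t_val \<omega> \<tau> \<delta> \<epsilon> v"
  shows "\<exists>c>0. u = c *\<^sub>R v"
proof -
  let ?a = "pairing (perturb \<omega> \<delta>) u" and ?b = "pairing (perturb \<omega> \<delta>) v"
  have pos: "0 < ?a" "0 < ?b" using perturb_signs u v by auto
  have mem: "u \<in> partial_ideal I" "v \<in> partial_ideal I" using u v by auto
  have "?b * pairing (perturb \<tau> \<epsilon>) u = ?a * pairing (perturb \<tau> \<epsilon>) v"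
    using eq unfolding t_val_def ratio_compare(2)[OF perturb_signs[OF u] perturb_signs[OF v]] .
  then have "\<not> rat_order \<tau> (?b *\<^sub>R u) (?a *\<^sub>R v)" "\<not> rat_order \<tau> (?a *\<^sub>R v) (?b *\<^sub>R u)"
    using represents_on_N_compare[OF mem] represents_on_N_compare[OF mem(2,1)] by auto
  then have "?b *\<^sub>R u = ?a *\<^sub>R v"
    using rat_order_linear \<tau> unfolding rat_term_order_def by blast
  then have "(1 / ?b) *\<^sub>R (?b *\<^sub>R u) = (1 / ?b) *\<^sub>R (?a *\<^sub>R v)" by simp
  then have "u = (?a / ?b) *\<^sub>R v" using pos by simp
  then show ?thesis using pos by (intro exI[of _ "?a / ?b"]) simp
qed

end

lemma outer_commute_if_multiple: "u = c *\<^sub>R v \<Longrightarrow> outer u v = outer v u"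
  by (simp add: vec_eq_iff outer_def matrix_matrix_mult_def columnvector_def rowvector_def)

theorem mainTheorem2:
  fixes I :: "('n::{finite,linorder}, 'k::field) mpoly set"
    and \<omega> \<tau> :: "'n \<Rightarrow> 'n qvec"
  assumes "is_ideal I"
    and "rat_term_order \<omega>"
    and "rat_term_order \<tau>"
  defines "T \<equiv> row_matrix \<tau>"
  shows "(\<exists>\<delta>>0. represents_on \<omega> \<delta> (M_set \<tau> I)) \<and>
    (\<forall>\<delta>>0. represents_on \<omega> \<delta> (M_set \<tau> I) \<longrightarrow>
      (\<exists>\<epsilon>>0. represents_on \<tau> \<epsilon> (N_set \<omega> \<delta> I))) \<and>
    (\<forall>\<delta>>0. \<forall>\<epsilon>>0.
      represents_on \<omega> \<delta> (M_set \<tau> I) \<longrightarrow> represents_on \<tau> \<epsilon> (N_set \<omega> \<delta> I) \<longrightarrow>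
      (\<forall>u \<in> partial_ideal I \<inter> diff_cone (rat_order \<omega>) (rat_order \<tau>).
       \<forall>v \<in> partial_ideal I \<inter> diff_cone (rat_order \<omega>) (rat_order \<tau>).
        pairing (perturb \<omega> \<delta>) u > 0 \<and>
        pairing (perturb \<omega> \<delta>) v > 0 \<and>
        (t_val \<omega> \<tau> \<delta> \<epsilon> u < t_val \<omega> \<tau> \<delta> \<epsilon> v \<longleftrightarrow>
           lex_less (rat_order \<omega>) (T ** outer u v) (T ** outer v u)) \<and>
        (t_val \<omega> \<tau> \<delta> \<epsilon> u = t_val \<omega> \<tau> \<delta> \<epsilon> v \<longrightarrow>
           T ** outer u v = T ** outer v u \<and>
           outer u v = outer v u \<and>
           (\<exists>c>0. u = c *\<^sub>R v))))"
proof (intro conjI allI impI ballI)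
  have fin: "finite (partial_ideal I)" using assms(1) by (rule finite_partial_ideal)
  have "M_set \<tau> I = (\<lambda>(i, u, v). pairing (\<tau> i) u *\<^sub>R v) ` (UNIV \<times> partial_ideal I \<times> partial_ideal I)"
    unfolding M_set_def by force
  then have "finite (M_set \<tau> I)" using fin by simp
  then show "\<exists>\<delta>>0. represents_on \<omega> \<delta> (M_set \<tau> I)" by (rule represents_on_exists)
  have "N_set \<omega> \<delta> I =
      (\<lambda>(u, v). pairing (perturb \<omega> \<delta>) u *\<^sub>R v) ` (partial_ideal I \<times> partial_ideal I)" for \<delta>
    unfolding N_set_def by force
  then have "finite (N_set \<omega> \<delta> I)" for \<delta> using fin by simp
  then show "\<exists>\<epsilon>>0. represents_on \<tau> \<epsilon> (N_set \<omega> \<delta> I)" for \<delta> by (rule represents_on_exists)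
next
  fix \<delta> \<epsilon> u v
  assume rep: "represents_on \<omega> \<delta> (M_set \<tau> I)" "represents_on \<tau> \<epsilon> (N_set \<omega> \<delta> I)"
    and u: "u \<in> partial_ideal I \<inter> diff_cone (rat_order \<omega>) (rat_order \<tau>)"
    and v: "v \<in> partial_ideal I \<inter> diff_cone (rat_order \<omega>) (rat_order \<tau>)"
  note hyps = assms(1-3) rep
  show "pairing (perturb \<omega> \<delta>) u > 0" using perturb_signs(1)[OF hyps u] .
  show "pairing (perturb \<omega> \<delta>) v > 0" using perturb_signs(1)[OF hyps v] .
  show "t_val \<omega> \<tau> \<delta> \<epsilon> u < t_val \<omega> \<tau> \<delta> \<epsilon> v \<longleftrightarrow>
      lex_less (rat_order \<omega>) (T ** outer u v) (T ** outer v u)"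
    unfolding T_def using t_val_less_iff[OF hyps u v] .
  assume eq: "t_val \<omega> \<tau> \<delta> \<epsilon> u = t_val \<omega> \<tau> \<delta> \<epsilon> v"
  show multiple: "\<exists>c>0. u = c *\<^sub>R v" using t_val_eq_imp_multiple[OF hyps u v eq] .
  then show comm: "outer u v = outer v u" using outer_commute_if_multiple by blast
  show "T ** outer u v = T ** outer v u" unfolding comm ..
qed

end
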